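(* Let $\mathbf{k}$ be a field and let $\mathbb{X}: X_1 \subset X_2 \subset \dots \subset X_n = X_\infty$ be a filtered cell complex. Then for all $k$, $$\mathrm{Pers}(\mathrm{H}_k(\mathbb{X})) = \mathrm{Pers}(\mathrm{H}^k(\mathbb{X})), \qquad \mathrm{Pers}(\mathrm{H}_k(X_\infty, \mathbb{X})) = \mathrm{Pers}(\mathrm{H}^k(X_\infty, \mathbb{X})).$$ In other words, persistent homology and persistent cohomology have identical barcodes, both in the absolute and in the relative case.
   Context: All (co)homology is taken with coefficients in the fixed field $\mathbf{k}$. A filtered cell complex is a sequence of cell complexes $X_1 \subset X_2 \subset \dots \subset X_n = X_\infty$ where $X_1$ is a single vertex $\sigma_1$ and $X_i = X_{i-1}\cup\sigma_i$ is obtained from $X_{i-1}$ by adding a single cell $\sigma_i$. Real values $a_1\le a_2\le\dots\le a_n$ are attached to the indices. Convention: $X_0=\emptyset$. A persistence module is a finite sequence of finite-dimensional $\mathbf{k}$-vector spaces indexed by consecutive integers, with linear maps between consecutive terms all pointing in the same direction (all to the right or all to the left). It decomposes as a direct sum of interval modules $[p,q]$ (one-dimensional at indices $p,\dots,q$ with identity maps between them, zero elsewhere). $\mathrm{Pers}$ of a persistence module (its persistence diagram or barcode) is the multiset of the pairs $[p,q]$ occurring in such a decomposition. A pair $[p,q]$ is also interpreted as the half-open interval $[a_p,a_{q+1})$, with $a_0=-\infty$, $a_{n+1}=\infty$. The four persistence modules, with maps induced by inclusions, are - $\mathrm{H}_k(\mathbb{X}):\ \mathrm{H}_k(X_1)\to\dots\to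 \mathrm{H}_k(X_n)$, indexed by $1,\dots,n$; - $\mathrm{H}^k(\mathbb{X}):\ \mathrm{H}^k(X_1)\leftarrow\dots\leftarrow \mathrm{H}^k(X_n)$, indexed by $1,\dots,n$; - $\mathrm{H}_k(X_\infty,\mathbb{X}):\ \mathrm{H}_k(X_n)\to \mathrm{H}_k(X_n,X_1)\to\dots\to \mathrm{H}_k(X_n,X_{n-1})$, indexed by $0,\dots,n-1$; - $\mathrm{H}^k(X_\infty,\mathbb{X}):\ \mathrm{H}^k(X_n)\leftarrow \mathrm{H}^k(X_n,X_1)\leftarrow\dots\leftarrow \mathrm{H}^k(X_n,X_{n-1})$, indexed by $0,\dots,n-1$. *)

theory Defs
  imports
    "HOL-Homology.Homology"
    "HOL-Library.Poly_Mapping"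
    "HOL-Library.Function_Algebras"
    "HOL-Library.Set_Algebras"
    "HOL-Library.Multiset"
begin

section \<open>Persistence modules and their barcodes\<close>

text \<open>Vector spaces over the field \<open>'k\<close> are carrier-based \<open>module\<close> records; as scalars range over
  the whole type \<open>'k\<close>, no record for the field is needed. The (unused) ring multiplication and
  unit of such a record are \<open>undefined\<close>.\<close>

datatype direction = Rightward | Leftward

text \<open>The spaces are indexed by \<open>idx_lo, \<dots>, idx_hi\<close>. For \<open>idx_lo \<le> i < idx_hi\<close> the structure map
  \<open>trans_map i\<close> goes from space \<open>i\<close> to space \<open>Suc i\<close> if the module points to the right, and from
  space \<open>Suc i\<close> to space \<open>i\<close> if it points to the left.\<close>

record ('k, 'v) persistence_module =
  orientation :: direction
  idx_lo :: nat
  idx_hi :: nat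
  space_at :: "nat \<Rightarrow> ('k, 'v) module"
  trans_map :: "nat \<Rightarrow> 'v \<Rightarrow> 'v"

definition linear_iso :: "('k, 'v) module \<Rightarrow> ('k, 'w) module \<Rightarrow> ('v \<Rightarrow> 'w) \<Rightarrow> bool" where
  "linear_iso V W h \<longleftrightarrow>
     bij_betw h (carrier V) (carrier W) \<and>
     (\<forall>x\<in>carrier V. \<forall>y\<in>carrier V. h (x \<oplus>\<^bsub>V\<^esub> y) = h x \<oplus>\<^bsub>W\<^esub> h y) \<and>
     (\<forall>a. \<forall>x\<in>carrier V. h (a \<odot>\<^bsub>V\<^esub> x) = a \<odot>\<^bsub>W\<^esub> h x)"

definition pers_isomorphic ::
    "('k, 'v) persistence_module \<Rightarrow> ('k, 'w) persistence_module \<Rightarrow> bool" where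
  "pers_isomorphic V W \<longleftrightarrow>
     orientation V = orientation W \<and> idx_lo V = idx_lo W \<and> idx_hi V = idx_hi W \<and>
     (\<exists>h. (\<forall>i\<in>{idx_lo V..idx_hi V}. linear_iso (space_at V i) (space_at W i) (h i)) \<and>
          (\<forall>i\<in>{idx_lo V..<idx_hi V}.
             case orientation V of
               Rightward \<Rightarrow>
                 (\<forall>x\<in>carrier (space_at V i).
                    h (Suc i) (trans_map V i x) = trans_map W i (h i x))
             | Leftward \<Rightarrow>
                 (\<forall>x\<in>carrier (space_at V (Suc i)).
                    h i (trans_map V i x) = trans_map W i (h (Suc i) x))))"

text \<open>The same formula describes the structure maps of an interval module in both directions.\<close>

definition interval_module ::
    "direction \<Rightarrow> nat \<Rightarrow> nat \<Rightarrow> nat \<times> nat \<Rightarrow> ('k::field, 'k) persistence_module" where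
  "interval_module dir l u I =
     \<lparr> orientation = dir, idx_lo = l, idx_hi = u,
       space_at = (\<lambda>i. \<lparr> carrier = (if fst I \<le> i \<and> i \<le> snd I then UNIV else {0}),
                        monoid.mult = undefined, one = undefined,
                        zero = 0, add = (+), smult = (*) \<rparr>),
       trans_map = (\<lambda>i x. if fst I \<le> i \<and> Suc i \<le> snd I then x else 0) \<rparr>"

text \<open>Direct sum of the finite list \<open>[M 0, \<dots>, M (m - 1)]\<close> of persistence modules, all of orientation
  \<open>dir\<close> and indexed by \<open>l, \<dots>, u\<close>.\<close>

definition pers_direct_sum ::
    "direction \<Rightarrow> nat \<Rightarrow> nat \<Rightarrow> nat \<Rightarrow> (nat \<Rightarrow> ('k, 'v) persistence_module)
      \<Rightarrow> ('k, nat \<Rightarrow> 'v) persistence_module" where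
  "pers_direct_sum dir l u m M =
     \<lparr> orientation = dir, idx_lo = l, idx_hi = u,
       space_at = (\<lambda>i.
         \<lparr> carrier = (\<Pi>\<^sub>E j\<in>{..<m}. carrier (space_at (M j) i)),
           monoid.mult = undefined, one = undefined,
           zero = (\<lambda>j\<in>{..<m}. \<zero>\<^bsub>space_at (M j) i\<^esub>),
           add = (\<lambda>x y. \<lambda>j\<in>{..<m}. x j \<oplus>\<^bsub>space_at (M j) i\<^esub> y j),
           smult = (\<lambda>a x. \<lambda>j\<in>{..<m}. a \<odot>\<^bsub>space_at (M j) i\<^esub> x j) \<rparr>),
       trans_map = (\<lambda>i x. \<lambda>j\<in>{..<m}. trans_map (M j) i (x j)) \<rparr>"

definition is_barcode ::
    "('k::field, 'v) persistence_module \<Rightarrow> (nat \<times> nat) multiset \<Rightarrow> bool" where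
  "is_barcode V B \<longleftrightarrow>
     (\<exists>Is. mset Is = B \<and>
           (\<forall>(p, q)\<in>set Is. idx_lo V \<le> p \<and> p \<le> q \<and> q \<le> idx_hi V) \<and>
           pers_isomorphic V
             (pers_direct_sum (orientation V) (idx_lo V) (idx_hi V) (length Is)
               (\<lambda>j. interval_module (orientation V) (idx_lo V) (idx_hi V) (Is ! j)
                      :: ('k, 'k) persistence_module)))"

text \<open>Barcodes are unique by the Krull--Remak--Schmidt theorem, and exist exactly if all spaces are
  finite-dimensional; without a barcode, \<open>Pers\<close> is unspecified.\<close>

definition Pers :: "('k::field, 'v) persistence_module \<Rightarrow> (nat \<times> nat) multiset" where
  "Pers V = (THE B. is_barcode V B)"


section \<open>Singular homology and cohomology with coefficients in a field\<close>

text \<open>The quotient \<open>Z/B\<close> of linear subspaces \<open>B \<subseteq> Z\<close> of a type with scalar multiplication \<open>sc\<close>.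
  Addition of cosets is elementwise addition of sets.\<close>

definition quotient_space ::
    "('k \<Rightarrow> 'v \<Rightarrow> 'v) \<Rightarrow> 'v set \<Rightarrow> 'v set \<Rightarrow> ('k, 'v::ab_group_add set) module" where
  "quotient_space sc Z B =
     \<lparr> carrier = (\<lambda>z. z +o B) ` Z, monoid.mult = undefined, one = undefined,
       zero = B, add = (+), smult = (\<lambda>a S. sc a ` S + B) \<rparr>"

subsection \<open>Homology\<close>

text \<open>These definitions mirror those for integer coefficients in \<open>HOL-Homology\<close>: singular simplices
  of a subspace are literally singular simplices of the ambient space, so chain maps induced by
  inclusions are identities.\<close>

type_synonym ('k, 'a) fchain = "((nat \<Rightarrow> real) \<Rightarrow> 'a) \<Rightarrow>\<^sub>0 'k"

definition fchains :: "nat \<Rightarrow> 'a topology \<Rightarrow> ('k::field, 'a) fchain set" where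
  "fchains p X = {c. Poly_Mapping.keys c \<subseteq> singular_simplex_set p X}"

definition fboundary :: "nat \<Rightarrow> ('k::field, 'a) fchain \<Rightarrow> ('k, 'a) fchain" where
  "fboundary p c =
     (if p = 0 then 0
      else \<Sum>\<sigma>\<in>Poly_Mapping.keys c. \<Sum>i\<le>p.
             Poly_Mapping.single (singular_face p i \<sigma>) ((-1) ^ i * Poly_Mapping.lookup c \<sigma>))"

definition frelcycles :: "nat \<Rightarrow> 'a topology \<Rightarrow> 'a set \<Rightarrow> ('k::field, 'a) fchain set" where
  "frelcycles p X A = {c \<in> fchains p X. fboundary p c \<in> fchains (p - 1) (subtopology X A)}"

definition frelboundaries :: "nat \<Rightarrow> 'a topology \<Rightarrow> 'a set \<Rightarrow> ('k::field, 'a) fchain set" where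
  "frelboundaries p X A = fboundary (Suc p) ` fchains (Suc p) X + fchains p (subtopology X A)"

definition homology :: "nat \<Rightarrow> 'a topology \<Rightarrow> 'a set \<Rightarrow> ('k::field, ('k, 'a) fchain set) module" where
  "homology p X A =
     quotient_space (\<lambda>a. Poly_Mapping.map ((*) a)) (frelcycles p X A) (frelboundaries p X A)"

text \<open>The map into the homology of the pair \<open>(Y, C)\<close> induced by an inclusion of pairs.\<close>

definition homology_incl ::
    "nat \<Rightarrow> 'a topology \<Rightarrow> 'a set \<Rightarrow> ('k::field, 'a) fchain set \<Rightarrow> ('k, 'a) fchain set" where
  "homology_incl p Y C S = S + frelboundaries p Y C"

subsection \<open>Cohomology\<close>

text \<open>A cochain is a linear functional on chains, given by its values on singular simplices; to be
  determined by these it is set to \<open>0\<close> outside the singular \<open>p\<close>-simplices of \<open>X\<close>. The cochains of a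
  pair are those that vanish on the subspace.\<close>

type_synonym ('k, 'a) cochain = "((nat \<Rightarrow> real) \<Rightarrow> 'a) \<Rightarrow> 'k"

definition cochains :: "nat \<Rightarrow> 'a topology \<Rightarrow> 'a set \<Rightarrow> ('k::field, 'a) cochain set" where
  "cochains p X A =
     {\<phi>. (\<forall>\<sigma>. \<not> singular_simplex p X \<sigma> \<longrightarrow> \<phi> \<sigma> = 0) \<and>
         (\<forall>\<sigma>. singular_simplex p (subtopology X A) \<sigma> \<longrightarrow> \<phi> \<sigma> = 0)}"

definition coboundary ::
    "nat \<Rightarrow> 'a topology \<Rightarrow> ('k::field, 'a) cochain \<Rightarrow> ('k, 'a) cochain" where
  "coboundary p X \<phi> =
     (\<lambda>\<sigma>. if singular_simplex (Suc p) X \<sigma>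
           then \<Sum>i\<le>Suc p. (-1) ^ i * \<phi> (singular_face (Suc p) i \<sigma>) else 0)"

definition cocycles :: "nat \<Rightarrow> 'a topology \<Rightarrow> 'a set \<Rightarrow> ('k::field, 'a) cochain set" where
  "cocycles p X A = {\<phi> \<in> cochains p X A. coboundary p X \<phi> = 0}"

definition coboundaries :: "nat \<Rightarrow> 'a topology \<Rightarrow> 'a set \<Rightarrow> ('k::field, 'a) cochain set" where
  "coboundaries p X A =
     (case p of 0 \<Rightarrow> {0} | Suc q \<Rightarrow> coboundary q X ` cochains q X A)"

definition cohomology :: "nat \<Rightarrow> 'a topology \<Rightarrow> 'a set \<Rightarrow> ('k::field, ('k, 'a) cochain set) module" where
  "cohomology p X A =
     quotient_space (\<lambda>a \<phi> \<sigma>. a * \<phi> \<sigma>) (cocycles p X A) (coboundaries p X A)"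

text \<open>The map into the cohomology of the pair \<open>(Y, C)\<close> induced by an inclusion of \<open>(Y, C)\<close> into
  another pair.\<close>

definition cohomology_incl ::
    "nat \<Rightarrow> 'a topology \<Rightarrow> 'a set \<Rightarrow> ('k::field, 'a) cochain set \<Rightarrow> ('k, 'a) cochain set" where
  "cohomology_incl p Y C S =
     (\<lambda>\<phi> \<sigma>. if singular_simplex p Y \<sigma> then \<phi> \<sigma> else 0) ` S + coboundaries p Y C"


section \<open>Filtered cell complexes\<close>

definition ball_topology :: "nat \<Rightarrow> (nat \<Rightarrow> real) topology" where
  "ball_topology d = subtopology (Euclidean_space d) {x. (\<Sum>i<d. (x i)\<^sup>2) \<le> 1}"

definition ball_boundary :: "nat \<Rightarrow> (nat \<Rightarrow> real) set" where
  "ball_boundary d = {x \<in> topspace (ball_topology d). (\<Sum>i<d. (x i)\<^sup>2) = 1}"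

text \<open>\<open>X\<^sub>B\<close> arises from \<open>X\<^sub>A\<close>, for \<open>A \<subseteq> B\<close>, by attaching a \<open>d\<close>-cell with characteristic map \<open>\<Phi>\<close>: the
  open ball is mapped bijectively onto \<open>B - A\<close>, its boundary sphere is mapped into \<open>A\<close>, and \<open>X\<^sub>B\<close>
  carries the quotient topology of the disjoint union of \<open>X\<^sub>A\<close> and the closed ball.\<close>

definition attaches_cell ::
    "'a topology \<Rightarrow> 'a set \<Rightarrow> 'a set \<Rightarrow> nat \<Rightarrow> ((nat \<Rightarrow> real) \<Rightarrow> 'a) \<Rightarrow> bool" where
  "attaches_cell X A B d \<Phi> \<longleftrightarrow>
     A \<subseteq> B \<and>
     bij_betw \<Phi> (topspace (ball_topology d) - ball_boundary d) (B - A) \<and>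
     \<Phi> ` ball_boundary d \<subseteq> A \<and>
     (\<forall>U\<subseteq>B. openin (subtopology X B) U \<longleftrightarrow>
        openin (subtopology X A) (U \<inter> A) \<and>
        openin (ball_topology d) {x \<in> topspace (ball_topology d). \<Phi> x \<in> U})"

text \<open>\<open>X\<^sub>i\<close> is the subspace \<open>A i\<close> of \<open>X = X\<^sub>\<infinity>\<close>, and the open cell \<open>\<sigma>\<^sub>i\<close> is \<open>A i - A (i - 1)\<close>, of
  dimension \<open>dm i\<close>. The last condition is the CW condition that the boundary of a cell lies in the
  union of the cells of smaller dimension; it makes every \<open>X\<^sub>i\<close> a subcomplex.\<close>

definition filtered_cell_complex :: "'a topology \<Rightarrow> nat \<Rightarrow> (nat \<Rightarrow> 'a set) \<Rightarrow> bool" where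
  "filtered_cell_complex X n A \<longleftrightarrow>
     1 \<le> n \<and> A 0 = {} \<and> (\<exists>v. A 1 = {v}) \<and> A n = topspace X \<and>
     (\<exists>dm \<Phi>. \<forall>i\<in>{1..n}.
        attaches_cell X (A (i - 1)) (A i) (dm i) (\<Phi> i) \<and>
        \<Phi> i ` ball_boundary (dm i) \<subseteq> (\<Union>j\<in>{j. 1 \<le> j \<and> j < i \<and> dm j < dm i}. A j - A (j - 1)))"

definition abs_homology_pers ::
    "nat \<Rightarrow> 'a topology \<Rightarrow> nat \<Rightarrow> (nat \<Rightarrow> 'a set)
      \<Rightarrow> ('k::field, ('k, 'a) fchain set) persistence_module" where
  "abs_homology_pers k X n A =
     \<lparr> orientation = Rightward, idx_lo = 1, idx_hi = n,
       space_at = (\<lambda>i. homology k (subtopology X (A i)) {}),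
       trans_map = (\<lambda>i. homology_incl k (subtopology X (A (Suc i))) {}) \<rparr>"

definition abs_cohomology_pers ::
    "nat \<Rightarrow> 'a topology \<Rightarrow> nat \<Rightarrow> (nat \<Rightarrow> 'a set)
      \<Rightarrow> ('k::field, ('k, 'a) cochain set) persistence_module" where
  "abs_cohomology_pers k X n A =
     \<lparr> orientation = Leftward, idx_lo = 1, idx_hi = n,
       space_at = (\<lambda>i. cohomology k (subtopology X (A i)) {}),
       trans_map = (\<lambda>i. cohomology_incl k (subtopology X (A i)) {}) \<rparr>"

text \<open>As \<open>A 0 = {}\<close>, the first space in the relative modules is the absolute (co)homology of \<open>X\<^sub>\<infinity>\<close>.\<close>

definition rel_homology_pers ::
    "nat \<Rightarrow> 'a topology \<Rightarrow> nat \<Rightarrow> (nat \<Rightarrow> 'a set)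
      \<Rightarrow> ('k::field, ('k, 'a) fchain set) persistence_module" where
  "rel_homology_pers k X n A =
     \<lparr> orientation = Rightward, idx_lo = 0, idx_hi = n - 1,
       space_at = (\<lambda>i. homology k X (A i)),
       trans_map = (\<lambda>i. homology_incl k X (A (Suc i))) \<rparr>"

definition rel_cohomology_pers ::
    "nat \<Rightarrow> 'a topology \<Rightarrow> nat \<Rightarrow> (nat \<Rightarrow> 'a set)
      \<Rightarrow> ('k::field, ('k, 'a) cochain set) persistence_module" where
  "rel_cohomology_pers k X n A =
     \<lparr> orientation = Leftward, idx_lo = 0, idx_hi = n - 1,
       space_at = (\<lambda>i. cohomology k X (A i)),
       trans_map = (\<lambda>i. cohomology_incl k X (A i)) \<rparr>"

end

theory Submission
  imports Defs
begin

text \<open>Evaluation of cocycles on cycles pairs \<open>H\<^sub>k\<close> with \<open>H\<^sup>k\<close> of a pair of spaces. As linear functionals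
  on subspaces extend to the whole space, the pairing is nondegenerate on both sides, and it makes
  the maps that an inclusion induces in homology and cohomology adjoint to each other. If one of two
  persistence modules in such a duality is a sum of intervals, then the dual bases decompose the
  other one into the same intervals. So both modules have the same barcodes: finite-dimensionality,
  and with it the cell structure, only matters for their existence.\<close>

section \<open>Linear functionals\<close>

text \<open>Chain spaces are infinite-dimensional in general, and a nondegenerate pairing only
  embeds each side in the dual of the other. Finite coordinates on one side close the gap: a
  functional on a coordinate space is itself given by a vector of coefficients, so a functional that
  vanishes on the image of the other side comes from an element that pairs to zero with everything,
  hence is zero. The intervals survive dualization because, in coordinates adapted to them, a
  structure map is a diagonal matrix with entries 0 and 1: its transpose has the same entries, with
  the arrow reversed. Nondegeneracy of evaluation amounts to two annihilator statements. That a
  relative cycle annihilated by all cocycles bounds is separation from a subspace by a functional;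
  that a cocycle annihilating all cycles is a coboundary is factorization of a functional through
  the boundary map, with the extra demand of vanishing on the chains of the subspace.
  \<open>functional_factors\<close> supplies both.\<close>

lemma (in vector_space_pair) linear_extend_from_subspace:
  assumes T: "vs1.subspace T"
    and add: "\<And>x y. x \<in> T \<Longrightarrow> y \<in> T \<Longrightarrow> f (x + y) = f x + f y"
    and scale: "\<And>a x. x \<in> T \<Longrightarrow> f (s1 a x) = s2 a (f x)"
  shows "\<exists>g. Vector_Spaces.linear s1 s2 g \<and> (\<forall>x\<in>T. g x = f x)"
proof -
  obtain B where B: "B \<subseteq> T" "vs1.independent B" "T \<subseteq> vs1.span B"
    using vs1.basis_exists by metis
  obtain g where g: "Vector_Spaces.linear s1 s2 g" "\<forall>x\<in>B. g x = f x"
    using linear_independent_extend[OF B(2)] by blast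
  interpret g: Vector_Spaces.linear s1 s2 g by (rule g(1))
  have f0: "f 0 = 0"
    using scale[of 0 0] vs1.subspace_0[OF T] by simp
  \<comment> \<open>The set where \<open>g\<close> and \<open>f\<close> agree is a subspace of
    \<open>T\<close> that contains a basis of \<open>T\<close>.\<close>
  have "vs1.subspace {x \<in> T. g x = f x}"
    using T f0 by (auto intro!: vs1.subspaceI simp: vs1.subspace_0 vs1.subspace_add
        vs1.subspace_scale g.add g.scale add scale)
  moreover have "B \<subseteq> {x \<in> T. g x = f x}"
    using B(1) g(2) by blast
  ultimately have "vs1.span B \<subseteq> {x \<in> T. g x = f x}"
    by (rule vs1.span_minimal[rotated])
  with B(3) g(1) show ?thesis by blast
qed

text \<open>The condition \<open>ker\<close> makes \<open>D x + s \<mapsto> \<phi> x\<close> well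
  defined on \<open>T = D(C) + S\<close>, and linear functionals extend from \<open>T\<close>.
  Vanishing on \<open>S\<close> is what later makes the resulting cochain relative.\<close>

lemma (in vector_space_pair) functional_factors:
  assumes D: "Vector_Spaces.linear s1 s2 D"
    and C: "vs1.subspace C" and S: "vs2.subspace S"
    and \<phi>: "Vector_Spaces.linear s1 (*) \<phi>"
    and ker: "\<And>x. x \<in> C \<Longrightarrow> D x \<in> S \<Longrightarrow> \<phi> x = 0"
  shows "\<exists>\<psi>. Vector_Spaces.linear s2 (*) \<psi> \<and> (\<forall>x\<in>C. \<psi> (D x) = \<phi> x) \<and> (\<forall>y\<in>S. \<psi> y = 0)"
proof -
  interpret D: Vector_Spaces.linear s1 s2 D by (rule D)
  interpret \<phi>: Vector_Spaces.linear s1 "(*)" \<phi> by (rule \<phi>)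
  interpret F: vector_space_pair s2 "(*) :: 'a \<Rightarrow> 'a \<Rightarrow> 'a" ..
  define T where "T = {t. \<exists>x\<in>C. t - D x \<in> S}"
  define f where "f t = \<phi> (SOME x. x \<in> C \<and> t - D x \<in> S)" for t
  have f: "f t = \<phi> x" if "x \<in> C" "t - D x \<in> S" for t x
  proof -
    define y where "y = (SOME x. x \<in> C \<and> t - D x \<in> S)"
    have y: "y \<in> C \<and> t - D y \<in> S"
      unfolding y_def by (rule someI_ex) (use that in blast)
    have "D (y - x) = (t - D x) - (t - D y)" by (simp add: D.diff)
    then have "D (y - x) \<in> S" using vs2.subspace_diff[OF S that(2), of "t - D y"]
        vs2.subspace_diff[OF S conjunct2[OF y] that(2)]
        vs2.subspace_diff[OF S that(2) conjunct2[OF y]] by simp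
    then have "\<phi> (y - x) = 0" using ker vs1.subspace_diff[OF C] that y by blast
    then show ?thesis by (simp add: f_def y_def \<phi>.diff)
  qed
  have T_add: "\<exists>z\<in>C. t + u - D z \<in> S \<and> z = x + y"
    if "x \<in> C" "y \<in> C" "t - D x \<in> S" "u - D y \<in> S" for t u x y
    using vs1.subspace_add[OF C that(1,2)] vs2.subspace_add[OF S that(3,4)]
    by (simp add: D.add algebra_simps)
  have T_scale: "s2 a t - D (s1 a x) \<in> S" if "t - D x \<in> S" for a t x
    using vs2.subspace_scale[OF S that, of a] by (simp add: D.scale vs2.scale_right_diff_distrib)
  have "vs2.subspace T"
  proof (rule vs2.subspaceI)
    show "0 \<in> T"
      using vs1.subspace_0[OF C] vs2.subspace_0[OF S] by (auto simp: T_def intro!: bexI[of _ 0])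
    show "t + u \<in> T" if "t \<in> T" "u \<in> T" for t u
      using that T_add unfolding T_def by blast
    show "s2 a t \<in> T" if "t \<in> T" for a t
      using that T_scale vs1.subspace_scale[OF C] unfolding T_def by blast
  qed
  moreover have "f (t + u) = f t + f u" if tu: "t \<in> T" "u \<in> T" for t u
  proof -
    obtain x y where *: "x \<in> C" "y \<in> C" "t - D x \<in> S" "u - D y \<in> S"
      using tu by (auto simp: T_def)
    then obtain "x + y \<in> C" "t + u - D (x + y) \<in> S" using T_add by blast
    then show ?thesis using f * by (simp add: \<phi>.add)
  qed
  moreover have "f (s2 a t) = a * f t" if t: "t \<in> T" for a t
  proof -
    obtain x where *: "x \<in> C" "t - D x \<in> S" using t by (auto simp: T_def)
    then show ?thesis
      using f[OF *] f[OF vs1.subspace_scale[OF C *(1)] T_scale[OF *(2)]] by (simp add: \<phi>.scale)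
  qed
  ultimately obtain \<psi> where \<psi>: "Vector_Spaces.linear s2 (*) \<psi>" "\<forall>t\<in>T. \<psi> t = f t"
    using F.linear_extend_from_subspace[of T f] by blast
  have "\<psi> (D x) = \<phi> x" if "x \<in> C" for x
  proof -
    have "D x - D x \<in> S" using vs2.subspace_0[OF S] by simp
    with that have "D x \<in> T" "f (D x) = \<phi> x" using f unfolding T_def by blast+
    with \<psi>(2) show ?thesis by simp
  qed
  moreover have "\<psi> y = 0" if "y \<in> S" for y
  proof -
    have *: "y - D 0 \<in> S" "0 \<in> C" using that vs1.subspace_0[OF C] by simp_all
    then have "y \<in> T" "f y = \<phi> 0" using f unfolding T_def by blast+
    with \<psi>(2) show ?thesis by simp
  qed
  ultimately show ?thesis using \<psi>(1) by blast
qed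

text \<open>The map \<open>a \<mapsto> scale a x\<close> hits \<open>S\<close> only for
  \<open>a = 0\<close>, so the identity of the field factors through it modulo
  \<open>S\<close>.\<close>

lemma (in vector_space) separating_functional:
  assumes "subspace S" "x \<notin> S"
  shows "\<exists>\<psi>. Vector_Spaces.linear scale (*) \<psi> \<and> \<psi> x = 1 \<and> (\<forall>y\<in>S. \<psi> y = 0)"
proof -
  interpret P: vector_space_pair "(*) :: 'a \<Rightarrow> 'a \<Rightarrow> 'a" scale ..
  have "Vector_Spaces.linear (*) scale (\<lambda>a. scale a x)"
    by unfold_locales (simp_all add: algebra_simps)
  moreover have "a = 0" if "scale a x \<in> S" for a
    using subspace_scale[OF assms(1) that, of "inverse a"] assms(2) by (cases "a = 0") auto
  moreover have "Vector_Spaces.linear (*) (*) (\<lambda>a::'a. a)"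
    by unfold_locales simp_all
  ultimately obtain \<psi> where "Vector_Spaces.linear scale (*) \<psi>"
      "\<forall>a\<in>UNIV. \<psi> (scale a x) = a" "\<forall>y\<in>S. \<psi> y = 0"
    using P.functional_factors[of "\<lambda>a. scale a x" UNIV S "\<lambda>a. a"] assms(1)
    by auto
  then show ?thesis by (metis UNIV_I scale_one)
qed

text \<open>Serves twice: for cochains, and for coordinate vectors indexed by
  \<open>nat\<close>.\<close>

interpretation fun_space: vector_space "\<lambda>(a::'k::field) (\<phi>::'b \<Rightarrow> 'k) \<sigma>. a * \<phi> \<sigma>"
  by unfold_locales (simp_all add: fun_eq_iff algebra_simps)

lemma sum_fun_apply: "(\<Sum>i\<in>I. f i) x = (\<Sum>i\<in>I. f i x)"
  by (induction I rule: infinite_finite_induct) simp_all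


section \<open>Coordinate spaces and dual coordinates\<close>

text \<open>The value at one index of a direct sum of \<open>m\<close> interval modules, where \<open>P j\<close> says that the
  \<open>j\<close>-th interval contains that index.\<close>

definition coordinate_space :: "nat \<Rightarrow> (nat \<Rightarrow> bool) \<Rightarrow> ('k::field, nat \<Rightarrow> 'k) module" where
  "coordinate_space m P =
     \<lparr> carrier = (\<Pi>\<^sub>E j\<in>{..<m}. if P j then UNIV else {0}),
       monoid.mult = undefined, one = undefined, zero = (\<lambda>j\<in>{..<m}. 0),
       add = (\<lambda>x y. \<lambda>j\<in>{..<m}. x j + y j), smult = (\<lambda>a x. \<lambda>j\<in>{..<m}. a * x j) \<rparr>"

text \<open>Where \<open>P j\<close> fails this is the zero vector, so it lies in the coordinate
  space for every \<open>j\<close> and sums may run over all \<open>j < m\<close>.\<close>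

definition coordinate_vector :: "nat \<Rightarrow> (nat \<Rightarrow> bool) \<Rightarrow> nat \<Rightarrow> nat \<Rightarrow> 'k::field" where
  "coordinate_vector m P j = (\<lambda>l\<in>{..<m}. if l = j \<and> P j then 1 else 0)"

lemma coordinate_space_simps [simp]:
  "carrier (coordinate_space m P) = (\<Pi>\<^sub>E j\<in>{..<m}. if P j then UNIV else {0})"
  "x \<oplus>\<^bsub>coordinate_space m P\<^esub> y = (\<lambda>j\<in>{..<m}. x j + y j)"
  "a \<odot>\<^bsub>coordinate_space m P\<^esub> x = (\<lambda>j\<in>{..<m}. a * x j)"
  by (simp_all add: coordinate_space_def)

lemma coordinate_vector_in_carrier: "coordinate_vector m P j \<in> carrier (coordinate_space m P)"
  by (auto simp: coordinate_vector_def)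

text \<open>\<open>f\<close> is linear only on the carrier, whose addition is not that of a type
  class; hence an induction on the number \<open>n\<close> of leading coordinates of
  \<open>x\<close> that are kept.\<close>

lemma coordinate_functional_expand:
  fixes f :: "(nat \<Rightarrow> 'k::field) \<Rightarrow> 'k" and m P
  defines "K \<equiv> coordinate_space m P"
  assumes add: "\<And>x y. x \<in> carrier K \<Longrightarrow> y \<in> carrier K \<Longrightarrow> f (x \<oplus>\<^bsub>K\<^esub> y) = f x + f y"
    and scale: "\<And>a x. x \<in> carrier K \<Longrightarrow> f (a \<odot>\<^bsub>K\<^esub> x) = a * f x"
    and x: "x \<in> carrier K"
  shows "f x = (\<Sum>j<m. x j * f (coordinate_vector m P j))"
proof -
  have x0: "x j = 0" if "j < m" "\<not> P j" for j
    using PiE_mem[OF x[unfolded K_def coordinate_space_simps], of j] that by simp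
  have "f (\<lambda>j\<in>{..<m}. if j < n then x j else 0) = (\<Sum>j<n. x j * f (coordinate_vector m P j))"
    if "n \<le> m" for n
    using that
  proof (induction n)
    case 0
    have "(\<lambda>j\<in>{..<m}. 0) = 0 \<odot>\<^bsub>K\<^esub> x" by (simp add: K_def)
    then show ?case using scale[OF x, of 0] by simp
  next
    case (Suc n)
    let ?y = "\<lambda>j\<in>{..<m}. if j < n then x j else 0" and ?v = "coordinate_vector m P n"
    have y: "?y \<in> carrier K" using x0 by (auto simp: K_def)
    have v: "?v \<in> carrier K" unfolding K_def by (rule coordinate_vector_in_carrier)
    have xv: "x n \<odot>\<^bsub>K\<^esub> ?v \<in> carrier K" by (auto simp: K_def coordinate_vector_def)
    have "(\<lambda>j\<in>{..<m}. if j < Suc n then x j else 0) = ?y \<oplus>\<^bsub>K\<^esub> (x n \<odot>\<^bsub>K\<^esub> ?v)"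
      using x0 by (auto simp: K_def coordinate_vector_def less_Suc_eq fun_eq_iff)
    then have "f (\<lambda>j\<in>{..<m}. if j < Suc n then x j else 0) = f ?y + x n * f ?v"
      by (simp only: add[OF y xv] scale[OF v])
    with Suc show ?case by (simp only: sum.lessThan_Suc Suc_leD)
  qed
  moreover have "(\<lambda>j\<in>{..<m}. if j < m then x j else 0) = x"
    using x by (auto simp: K_def fun_eq_iff PiE_def extensional_def)
  ultimately show ?thesis by (metis order.refl)
qed

text \<open>The records are not assumed to be vector spaces and offer no subtraction, so separation
  compares two elements instead of asking for a zero kernel.\<close>

locale nondegenerate_pairing =
  fixes V :: "('k::field, 'v) module" and W :: "('k, 'w) module" and b :: "'v \<Rightarrow> 'w \<Rightarrow> 'k"
  assumes zero_left: "\<zero>\<^bsub>V\<^esub> \<in> carrier V" and zero_right: "\<zero>\<^bsub>W\<^esub> \<in> carrier W"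
    and add_closed_left: "x \<in> carrier V \<Longrightarrow> x' \<in> carrier V \<Longrightarrow> x \<oplus>\<^bsub>V\<^esub> x' \<in> carrier V"
    and add_closed_right: "y \<in> carrier W \<Longrightarrow> y' \<in> carrier W \<Longrightarrow> y \<oplus>\<^bsub>W\<^esub> y' \<in> carrier W"
    and smult_closed_left: "x \<in> carrier V \<Longrightarrow> a \<odot>\<^bsub>V\<^esub> x \<in> carrier V"
    and smult_closed_right: "y \<in> carrier W \<Longrightarrow> a \<odot>\<^bsub>W\<^esub> y \<in> carrier W"
    and add_left: "x \<in> carrier V \<Longrightarrow> x' \<in> carrier V \<Longrightarrow> y \<in> carrier W \<Longrightarrow>
      b (x \<oplus>\<^bsub>V\<^esub> x') y = b x y + b x' y"
    and add_right: "x \<in> carrier V \<Longrightarrow> y \<in> carrier W \<Longrightarrow> y' \<in> carrier W \<Longrightarrow>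
      b x (y \<oplus>\<^bsub>W\<^esub> y') = b x y + b x y'"
    and smult_left: "x \<in> carrier V \<Longrightarrow> y \<in> carrier W \<Longrightarrow> b (a \<odot>\<^bsub>V\<^esub> x) y = a * b x y"
    and smult_right: "x \<in> carrier V \<Longrightarrow> y \<in> carrier W \<Longrightarrow> b x (a \<odot>\<^bsub>W\<^esub> y) = a * b x y"
    and separates_left: "x \<in> carrier V \<Longrightarrow> x' \<in> carrier V \<Longrightarrow>
      (\<And>y. y \<in> carrier W \<Longrightarrow> b x y = b x' y) \<Longrightarrow> x = x'"
    and separates_right: "y \<in> carrier W \<Longrightarrow> y' \<in> carrier W \<Longrightarrow>
      (\<And>x. x \<in> carrier V \<Longrightarrow> b x y = b x y') \<Longrightarrow> y = y'"

lemma nondegenerate_pairing_flip: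
  assumes "nondegenerate_pairing V W b"
  shows "nondegenerate_pairing W V (\<lambda>y x. b x y)"
proof -
  interpret nondegenerate_pairing V W b by (rule assms)
  show ?thesis
    by unfold_locales (simp_all add: zero_left zero_right add_closed_left add_closed_right
        smult_closed_left smult_closed_right add_left add_right smult_left smult_right
        separates_left separates_right)
qed

text \<open>Coordinates of \<open>w\<close> with respect to the basis dual to the one that corresponds to the
  coordinates \<open>h\<close> of \<open>V\<close>.\<close>

definition dual_coordinates ::
    "('k::field, 'v) module \<Rightarrow> ('v \<Rightarrow> 'w \<Rightarrow> 'k) \<Rightarrow> nat \<Rightarrow> (nat \<Rightarrow> bool) \<Rightarrow> ('v \<Rightarrow> nat \<Rightarrow> 'k)
      \<Rightarrow> 'w \<Rightarrow> nat \<Rightarrow> 'k" where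
  "dual_coordinates V b m P h w =
     (\<lambda>j\<in>{..<m}. b (inv_into (carrier V) h (coordinate_vector m P j)) w)"

context nondegenerate_pairing
begin

text \<open>Transported along \<open>h\<close>, pairing with a fixed \<open>w\<close> is a linear
  functional of the coordinates; its values on the coordinate vectors are the dual coordinates of
  \<open>w\<close>.\<close>

lemma pairing_in_coordinates:
  assumes h: "linear_iso V (coordinate_space m P) h"
    and x: "x \<in> carrier V" and w: "w \<in> carrier W"
  shows "b x w = (\<Sum>j<m. h x j * dual_coordinates V b m P h w j)"
proof -
  let ?K = "coordinate_space m P" and ?u = "inv_into (carrier V) h"
  have bij: "bij_betw h (carrier V) (carrier ?K)"
    using h by (simp add: linear_iso_def)
  have u: "?u y \<in> carrier V" "h (?u y) = y" if "y \<in> carrier ?K" for y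
    using bij_betwE[OF bij_betw_inv_into[OF bij]] bij_betw_inv_into_right[OF bij] that by blast+
  have "b (?u (y \<oplus>\<^bsub>?K\<^esub> y')) w = b (?u y) w + b (?u y') w"
    if "y \<in> carrier ?K" "y' \<in> carrier ?K" for y y'
  proof -
    have "h (?u y \<oplus>\<^bsub>V\<^esub> ?u y') = y \<oplus>\<^bsub>?K\<^esub> y'"
      using h u that unfolding linear_iso_def by metis
    then have "?u (y \<oplus>\<^bsub>?K\<^esub> y') = ?u y \<oplus>\<^bsub>V\<^esub> ?u y'"
      using bij_betw_inv_into_left[OF bij] add_closed_left u that by metis
    then show ?thesis using add_left u that w by simp
  qed
  moreover have "b (?u (a \<odot>\<^bsub>?K\<^esub> y)) w = a * b (?u y) w" if "y \<in> carrier ?K" for a y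
  proof -
    have "h (a \<odot>\<^bsub>V\<^esub> ?u y) = a \<odot>\<^bsub>?K\<^esub> y"
      using h u that unfolding linear_iso_def by metis
    then have "?u (a \<odot>\<^bsub>?K\<^esub> y) = a \<odot>\<^bsub>V\<^esub> ?u y"
      using bij_betw_inv_into_left[OF bij] smult_closed_left u that by metis
    then show ?thesis using smult_left u that w by simp
  qed
  moreover have "h x \<in> carrier ?K" using bij_betwE[OF bij] x by blast
  ultimately have "b (?u (h x)) w = (\<Sum>j<m. h x j * b (?u (coordinate_vector m P j)) w)"
    by (rule coordinate_functional_expand[where f = "\<lambda>y. b (?u y) w"])
  then show ?thesis
    using bij_betw_inv_into_left[OF bij x] by (simp add: dual_coordinates_def)
qed

text \<open>Injectivity is separation, as the dual coordinates of \<open>w\<close> determine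
  \<open>b x w\<close> for all \<open>x\<close>. For surjectivity, the coefficients of a functional
  that kills the image but not \<open>y\<close> would be the coordinates of an element of
  \<open>V\<close> orthogonal to all of \<open>W\<close>, hence zero.\<close>

lemma linear_iso_dual_coordinates:
  assumes h: "linear_iso V (coordinate_space m P) h"
  shows "linear_iso W (coordinate_space m P) (dual_coordinates V b m P h)"
proof -
  let ?K = "coordinate_space m P :: ('k, nat \<Rightarrow> 'k) module"
  let ?u = "inv_into (carrier V) h" and ?g = "dual_coordinates V b m P h"
  have bij: "bij_betw h (carrier V) (carrier ?K)"
    using h by (simp add: linear_iso_def)
  have u: "?u y \<in> carrier V" "h (?u y) = y" if "y \<in> carrier ?K" for y
    using bij_betwE[OF bij_betw_inv_into[OF bij]] bij_betw_inv_into_right[OF bij] that by blast+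
  note uv = u[OF coordinate_vector_in_carrier]
  have g_add: "?g (y \<oplus>\<^bsub>W\<^esub> y') = ?g y \<oplus>\<^bsub>?K\<^esub> ?g y'" if "y \<in> carrier W" "y' \<in> carrier W" for y y'
    using that by (simp add: dual_coordinates_def uv(1) add_right cong: restrict_cong)
  have g_smult: "?g (a \<odot>\<^bsub>W\<^esub> y) = a \<odot>\<^bsub>?K\<^esub> ?g y" if "y \<in> carrier W" for a y
    using that by (simp add: dual_coordinates_def uv(1) smult_right cong: restrict_cong)
  \<comment> \<open>Where \<open>P j\<close> fails the coordinate vector is zero, so its preimage
    under \<open>h\<close> pairs to 0 with everything.\<close>
  have g_zero: "?g w j = 0" if w: "w \<in> carrier W" and j: "j < m" "\<not> P j" for w j
  proof -
    have "h (?u (coordinate_vector m P j)) l = 0" if "l < m" for l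
      using uv(2)[of j] j that by (simp add: coordinate_vector_def)
    then have "b (?u (coordinate_vector m P j)) w = 0"
      using pairing_in_coordinates[OF h uv(1) w, of j] by simp
    then show ?thesis using j by (simp add: dual_coordinates_def)
  qed
  have g_carrier: "?g w \<in> carrier ?K" if "w \<in> carrier W" for w
    using g_zero[OF that] by (auto simp: dual_coordinates_def)
  have "inj_on ?g (carrier W)"
    by (intro inj_onI separates_right) (simp_all add: pairing_in_coordinates[OF h])
  moreover have "y \<in> ?g ` carrier W" if y: "y \<in> carrier ?K" for y
  proof (rule ccontr)
    assume contr: "y \<notin> ?g ` carrier W"
    \<comment> \<open>Coordinate vectors are \<open>undefined\<close> outside \<open>{..<m}\<close>;
      \<open>z\<close> puts 0 there, so that they become elements of \<open>fun_space\<close>, where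
      separation by functionals is available.\<close>
    define z where "z v = (\<lambda>j. if j < m then v j else (0::'k))" for v
    have z_eq: "v = v'" if "v \<in> carrier ?K" "v' \<in> carrier ?K" "z v = z v'" for v v'
    proof (rule PiE_ext[OF that(1,2)[simplified]])
      show "v j = v' j" if "j \<in> {..<m}" for j
        using fun_cong[OF \<open>z v = z v'\<close>, of j] that by (simp add: z_def)
    qed
    have "fun_space.subspace ((\<lambda>w. z (?g w)) ` carrier W)"
    proof (rule fun_space.subspaceI)
      have "z (?g (0 \<odot>\<^bsub>W\<^esub> \<zero>\<^bsub>W\<^esub>)) = 0"
        by (auto simp: g_smult zero_right z_def)
      then show "0 \<in> (\<lambda>w. z (?g w)) ` carrier W"
        using smult_closed_right[OF zero_right, of 0] by (metis imageI)
      show "v + v' \<in> (\<lambda>w. z (?g w)) ` carrier W"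
        if vv': "v \<in> (\<lambda>w. z (?g w)) ` carrier W" "v' \<in> (\<lambda>w. z (?g w)) ` carrier W" for v v'
      proof -
        obtain w w' where w: "w \<in> carrier W" "v = z (?g w)" "w' \<in> carrier W" "v' = z (?g w')"
          using vv' by blast
        then have "v + v' = z (?g (w \<oplus>\<^bsub>W\<^esub> w'))"
          by (auto simp: g_add z_def)
        then show ?thesis using w add_closed_right by blast
      qed
      show "(\<lambda>j. a * v j) \<in> (\<lambda>w. z (?g w)) ` carrier W"
        if v: "v \<in> (\<lambda>w. z (?g w)) ` carrier W" for a v
      proof -
        obtain w where w: "w \<in> carrier W" "v = z (?g w)" using v by blast
        then have "(\<lambda>j. a * v j) = z (?g (a \<odot>\<^bsub>W\<^esub> w))"
          by (auto simp: g_smult z_def)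
        then show ?thesis using w smult_closed_right by blast
      qed
    qed
    moreover have "z y \<notin> (\<lambda>w. z (?g w)) ` carrier W"
      using contr z_eq y g_carrier by blast
    ultimately obtain \<psi> where \<psi>: "Vector_Spaces.linear (\<lambda>a v j. a * v j) (*) \<psi>"
        "\<psi> (z y) = 1" "\<forall>v\<in>(\<lambda>w. z (?g w)) ` carrier W. \<psi> v = 0"
      using fun_space.separating_functional by blast
    interpret \<psi>: Vector_Spaces.linear "\<lambda>(a::'k) (v::nat \<Rightarrow> 'k) j. a * v j" "(*)" \<psi> by (rule \<psi>(1))
    define e where "e j = (\<lambda>l. if l = j then 1 else (0::'k))" for j :: nat
    have \<psi>_expand: "\<psi> (z v) = (\<Sum>j<m. v j * \<psi> (e j))" for v
    proof -
      have "z v = (\<Sum>j<m. (\<lambda>l. v j * e j l))"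
        by (auto simp: fun_eq_iff sum_fun_apply e_def z_def if_distrib cong: if_cong)
      then show ?thesis by (simp add: \<psi>.sum \<psi>.scale)
    qed
    \<comment> \<open>The coefficients of \<open>\<psi>\<close>, cleared where \<open>P\<close>
      fails so that they form a vector of the space; dual coordinates and \<open>y\<close> vanish
      there as well. The zero vector \<open>o'\<close> is what \<open>c\<close> is compared with in
      the two-element form of separation.\<close>
    define c :: "nat \<Rightarrow> 'k" where "c = (\<lambda>j\<in>{..<m}. if P j then \<psi> (e j) else 0)"
    define o' :: "nat \<Rightarrow> 'k" where "o' = (\<lambda>j\<in>{..<m}. 0)"
    have c: "c \<in> carrier ?K" and o': "o' \<in> carrier ?K" by (auto simp: c_def o'_def)
    have "b (?u c) w = b (?u o') w" if w: "w \<in> carrier W" for w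
    proof -
      have "b (?u c) w = (\<Sum>j<m. ?g w j * \<psi> (e j))"
        unfolding pairing_in_coordinates[OF h u(1)[OF c] w] u(2)[OF c]
        by (rule sum.cong) (auto simp: c_def g_zero[OF w])
      also have "\<dots> = 0"
        using \<psi>_expand[of "?g w"] \<psi>(3) w by simp
      also have "\<dots> = b (?u o') w"
        unfolding pairing_in_coordinates[OF h u(1)[OF o'] w] u(2)[OF o'] by (simp add: o'_def)
      finally show ?thesis .
    qed
    then have "?u c = ?u o'" using separates_left u c o' by blast
    then have "c = o'" using u c o' by metis
    then have "\<psi> (e j) = 0" if "j < m" "P j" for j
      using that by (auto simp: c_def o'_def fun_eq_iff split: if_splits)
    moreover have "y j = 0" if "j < m" "\<not> P j" for j
      using PiE_mem[OF y[unfolded coordinate_space_simps], of j] that by simp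
    ultimately have "(\<Sum>j<m. y j * \<psi> (e j)) = 0"
      by (intro sum.neutral) auto
    then show False using \<psi>(2) \<psi>_expand[of y] by simp
  qed
  then have "?g ` carrier W = carrier ?K" using g_carrier by blast
  ultimately show ?thesis
    using g_add g_smult by (simp add: linear_iso_def bij_betw_def)
qed

end

text \<open>By \<open>natural\<close>, \<open>t\<close> is a diagonal 0/1 matrix in the given
  coordinates. The adjoint \<open>s\<close> has the transposed matrix in the dual coordinates, which
  is the same one.\<close>

lemma dual_coordinates_natural:
  assumes pairing: "nondegenerate_pairing V W b" "nondegenerate_pairing V' W' b'"
    and h: "linear_iso V (coordinate_space m P) h" "linear_iso V' (coordinate_space m P') h'"
    and t: "\<And>x. x \<in> carrier V \<Longrightarrow> t x \<in> carrier V'"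
    and adjoint: "\<And>x. x \<in> carrier V \<Longrightarrow> b' (t x) w = b x (s w)"
    and natural: "\<And>x. x \<in> carrier V \<Longrightarrow>
      h' (t x) = (\<lambda>j\<in>{..<m}. if P j \<and> P' j then h x j else 0)"
    and w: "w \<in> carrier W'"
  shows "dual_coordinates V b m P h (s w) =
    (\<lambda>j\<in>{..<m}. if P j \<and> P' j then dual_coordinates V' b' m P' h' w j else 0)"
proof -
  interpret V': nondegenerate_pairing V' W' b' by (rule pairing(2))
  have bij: "bij_betw h (carrier V) (carrier (coordinate_space m P))"
    using h(1) by (simp add: linear_iso_def)
  have "b (inv_into (carrier V) h (coordinate_vector m P j)) (s w) =
      (if P j \<and> P' j then dual_coordinates V' b' m P' h' w j else 0)" if j: "j < m" for j
  proof -
    define u where "u = inv_into (carrier V) h (coordinate_vector m P j)"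
    have u: "u \<in> carrier V" "h u = coordinate_vector m P j"
      using bij_betwE[OF bij_betw_inv_into[OF bij]] bij_betw_inv_into_right[OF bij]
        coordinate_vector_in_carrier unfolding u_def by blast+
    have "b u (s w) = b' (t u) w" using adjoint u by simp
    also have "\<dots> = (\<Sum>l<m. h' (t u) l * dual_coordinates V' b' m P' h' w l)"
      by (rule V'.pairing_in_coordinates[OF h(2) t[OF u(1)] w])
    \<comment> \<open>As \<open>h u\<close> is the \<open>j\<close>-th coordinate vector, only the
      term \<open>l = j\<close> can be nonzero.\<close>
    also have "\<dots> = (\<Sum>l<m. if l = j then
        (if P j \<and> P' j then dual_coordinates V' b' m P' h' w j else 0) else 0)"
      by (rule sum.cong) (auto simp: natural[OF u(1)] u(2) coordinate_vector_def)
    finally show ?thesis using j by (simp add: u_def)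
  qed
  then show ?thesis
    by (auto simp: dual_coordinates_def[of V] fun_eq_iff)
qed


section \<open>Barcodes of adjoint persistence modules\<close>

text \<open>The structure map of a sum of intervals between the indices \<open>i\<close> and
  \<open>Suc i\<close>, in coordinates.\<close>

definition truncate_coordinates ::
    "(nat \<times> nat) list \<Rightarrow> nat \<Rightarrow> (nat \<Rightarrow> 'k::field) \<Rightarrow> nat \<Rightarrow> 'k" where
  "truncate_coordinates Is i x =
     (\<lambda>j\<in>{..<length Is}. if fst (Is ! j) \<le> i \<and> Suc i \<le> snd (Is ! j) then x j else 0)"

definition interval_coordinates :: "(nat \<times> nat) list \<Rightarrow> nat \<Rightarrow> ('k::field, nat \<Rightarrow> 'k) module" where
  "interval_coordinates Is i =
     coordinate_space (length Is) (\<lambda>j. fst (Is ! j) \<le> i \<and> i \<le> snd (Is ! j))"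

text \<open>Strips the direct sum of interval modules down to bare coordinate spaces, the form in
  which dual coordinates apply. The list \<open>Is\<close> orders the bars and is what both sides of
  the duality share.\<close>

lemma is_barcode_iff:
  fixes V :: "('k::field, 'v) persistence_module"
  shows "is_barcode V B \<longleftrightarrow>
     (\<exists>Is. mset Is = B \<and> (\<forall>(p, q)\<in>set Is. idx_lo V \<le> p \<and> p \<le> q \<and> q \<le> idx_hi V) \<and>
       (\<exists>h. (\<forall>i\<in>{idx_lo V..idx_hi V}. linear_iso (space_at V i) (interval_coordinates Is i) (h i)) \<and>
       (\<forall>i\<in>{idx_lo V..<idx_hi V}.
          case orientation V of
            Rightward \<Rightarrow> (\<forall>x\<in>carrier (space_at V i).
              h (Suc i) (trans_map V i x) = truncate_coordinates Is i (h i x))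
          | Leftward \<Rightarrow> (\<forall>x\<in>carrier (space_at V (Suc i)).
              h i (trans_map V i x) = truncate_coordinates Is i (h (Suc i) x)))))"
proof -
  define S where "S Is = pers_direct_sum (orientation V) (idx_lo V) (idx_hi V) (length Is)
      (\<lambda>j. interval_module (orientation V) (idx_lo V) (idx_hi V) (Is ! j)
        :: ('k, 'k) persistence_module)" for Is :: "(nat \<times> nat) list"
  have "space_at (S Is) i = interval_coordinates Is i" for Is i
    by (simp add: S_def pers_direct_sum_def interval_module_def interval_coordinates_def
        coordinate_space_def)
  moreover have "trans_map (S Is) i = truncate_coordinates Is i" for Is i
    by (simp add: S_def pers_direct_sum_def interval_module_def truncate_coordinates_def fun_eq_iff)
  moreover have "orientation (S Is) = orientation V" "idx_lo (S Is) = idx_lo V"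
      "idx_hi (S Is) = idx_hi V" for Is
    by (simp_all add: S_def pers_direct_sum_def)
  ultimately show ?thesis
    unfolding is_barcode_def S_def[symmetric] pers_isomorphic_def
    by (cases "orientation V") simp_all
qed

text \<open>Closure under the structure maps is part of the relation because a
  \<open>persistence_module\<close> record does not enforce it.\<close>

definition adjoint_modules ::
    "('k::field, 'v) persistence_module \<Rightarrow> ('k, 'w) persistence_module
      \<Rightarrow> (nat \<Rightarrow> 'v \<Rightarrow> 'w \<Rightarrow> 'k) \<Rightarrow> bool" where
  "adjoint_modules V W b \<longleftrightarrow>
     orientation V = Rightward \<and> orientation W = Leftward \<and>
     idx_lo V = idx_lo W \<and> idx_hi V = idx_hi W \<and>
     (\<forall>i\<in>{idx_lo V..idx_hi V}. nondegenerate_pairing (space_at V i) (space_at W i) (b i)) \<and>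
     (\<forall>i\<in>{idx_lo V..<idx_hi V}.
        (\<forall>x\<in>carrier (space_at V i). trans_map V i x \<in> carrier (space_at V (Suc i))) \<and>
        (\<forall>y\<in>carrier (space_at W (Suc i)). trans_map W i y \<in> carrier (space_at W i)) \<and>
        (\<forall>x\<in>carrier (space_at V i). \<forall>y\<in>carrier (space_at W (Suc i)).
           b (Suc i) (trans_map V i x) y = b i x (trans_map W i y)))"

text \<open>Separates the condition at \<open>i\<close> from the one at \<open>Suc i\<close>, the
  form \<open>P j \<and> P' j\<close> that \<open>dual_coordinates_natural\<close> expects.\<close>

lemma truncate_coordinates_alt:
  "truncate_coordinates Is i x =
     (\<lambda>j\<in>{..<length Is}. if (fst (Is ! j) \<le> i \<and> i \<le> snd (Is ! j)) \<and>
        (fst (Is ! j) \<le> Suc i \<and> Suc i \<le> snd (Is ! j)) then x j else 0)"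
  unfolding truncate_coordinates_def by (rule restrict_ext) auto

text \<open>Dual coordinates at each index turn a decomposition of one module into one of the other
  with the same list \<open>Is\<close>. Since the pairing separates on both sides, the converse is
  the same argument for the flipped pairing.\<close>

lemma is_barcode_adjoint:
  assumes "adjoint_modules V W b"
  shows "is_barcode V B \<longleftrightarrow> is_barcode W B"
proof -
  have orient [simp]: "orientation V = Rightward" "orientation W = Leftward"
    and lo: "idx_lo V = idx_lo W" and hi: "idx_hi V = idx_hi W"
    and pairing: "\<And>i. i \<in> {idx_lo W..idx_hi W} \<Longrightarrow>
      nondegenerate_pairing (space_at V i) (space_at W i) (b i)"
    and V_closed: "\<And>i x. i \<in> {idx_lo W..<idx_hi W} \<Longrightarrow> x \<in> carrier (space_at V i) \<Longrightarrow>
      trans_map V i x \<in> carrier (space_at V (Suc i))"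
    and W_closed: "\<And>i y. i \<in> {idx_lo W..<idx_hi W} \<Longrightarrow> y \<in> carrier (space_at W (Suc i)) \<Longrightarrow>
      trans_map W i y \<in> carrier (space_at W i)"
    and adjoint: "\<And>i x y. i \<in> {idx_lo W..<idx_hi W} \<Longrightarrow> x \<in> carrier (space_at V i) \<Longrightarrow>
      y \<in> carrier (space_at W (Suc i)) \<Longrightarrow>
      b (Suc i) (trans_map V i x) y = b i x (trans_map W i y)"
    using assms unfolding adjoint_modules_def by auto
  define alive where
    "alive Is i j \<longleftrightarrow> fst (Is ! j) \<le> i \<and> i \<le> snd (Is ! j)" for Is :: "(nat \<times> nat) list" and i j
  have coords: "interval_coordinates Is i = coordinate_space (length Is) (alive Is i)" for Is i
    by (simp add: interval_coordinates_def alive_def[abs_def])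
  \<comment> \<open>Both orders of the conjunction are recorded: \<open>P\<close> and
    \<open>P'\<close> swap roles with the direction of the map that is dualized.\<close>
  have trunc: "truncate_coordinates Is i x =
      (\<lambda>j\<in>{..<length Is}. if alive Is i j \<and> alive Is (Suc i) j then x j else 0)"
      "truncate_coordinates Is i x =
      (\<lambda>j\<in>{..<length Is}. if alive Is (Suc i) j \<and> alive Is i j then x j else 0)"
    for Is i and x :: "nat \<Rightarrow> 'a"
    by (simp_all only: truncate_coordinates_alt alive_def conj_commute)
  show ?thesis
  proof
    assume "is_barcode V B"
    then obtain Is h where Is: "mset Is = B"
        "\<forall>(p, q)\<in>set Is. idx_lo W \<le> p \<and> p \<le> q \<and> q \<le> idx_hi W"
      and iso: "\<forall>i\<in>{idx_lo W..idx_hi W}.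
        linear_iso (space_at V i) (coordinate_space (length Is) (alive Is i)) (h i)"
      and natural: "\<forall>i\<in>{idx_lo W..<idx_hi W}. \<forall>x\<in>carrier (space_at V i).
        h (Suc i) (trans_map V i x) = truncate_coordinates Is i (h i x)"
      unfolding is_barcode_iff coords by (auto simp: lo hi)
    note iso = iso[rule_format] and natural = natural[rule_format]
    define g where "g i = dual_coordinates (space_at V i) (b i) (length Is) (alive Is i) (h i)" for i
    have "linear_iso (space_at W i) (interval_coordinates Is i) (g i)"
      if "i \<in> {idx_lo W..idx_hi W}" for i
      unfolding g_def coords
      by (rule nondegenerate_pairing.linear_iso_dual_coordinates[OF pairing[OF that] iso[OF that]])
    moreover have "g i (trans_map W i y) = truncate_coordinates Is i (g (Suc i) y)"
      if i: "i \<in> {idx_lo W..<idx_hi W}" and y: "y \<in> carrier (space_at W (Suc i))" for i y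
    proof -
      have i': "i \<in> {idx_lo W..idx_hi W}" "Suc i \<in> {idx_lo W..idx_hi W}" using i by auto
      show ?thesis unfolding g_def trunc(1)
        by (rule dual_coordinates_natural[where t = "trans_map V i" and s = "trans_map W i",
              OF pairing[OF i'(1)] pairing[OF i'(2)]
              iso[OF i'(1)] iso[OF i'(2)] V_closed[OF i] adjoint[OF i _ y]
              natural[OF i, unfolded trunc(1)] y])
    qed
    ultimately show "is_barcode W B"
      unfolding is_barcode_iff using Is by (auto intro!: exI[of _ Is] exI[of _ g])
  next
    assume "is_barcode W B"
    then obtain Is h where Is: "mset Is = B"
        "\<forall>(p, q)\<in>set Is. idx_lo W \<le> p \<and> p \<le> q \<and> q \<le> idx_hi W"
      and iso: "\<forall>i\<in>{idx_lo W..idx_hi W}.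
        linear_iso (space_at W i) (coordinate_space (length Is) (alive Is i)) (h i)"
      and natural: "\<forall>i\<in>{idx_lo W..<idx_hi W}. \<forall>x\<in>carrier (space_at W (Suc i)).
        h i (trans_map W i x) = truncate_coordinates Is i (h (Suc i) x)"
      unfolding is_barcode_iff coords by auto
    note iso = iso[rule_format] and natural = natural[rule_format]
    define b' where "b' i = (\<lambda>y x. b i x y)" for i
    have pairing': "nondegenerate_pairing (space_at W i) (space_at V i) (b' i)"
      if "i \<in> {idx_lo W..idx_hi W}" for i
      unfolding b'_def by (rule nondegenerate_pairing_flip[OF pairing[OF that]])
    define g where "g i = dual_coordinates (space_at W i) (b' i) (length Is) (alive Is i) (h i)" for i
    have "linear_iso (space_at V i) (interval_coordinates Is i) (g i)"
      if "i \<in> {idx_lo W..idx_hi W}" for i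
      unfolding g_def coords
      by (rule nondegenerate_pairing.linear_iso_dual_coordinates[OF pairing'[OF that] iso[OF that]])
    moreover have "g (Suc i) (trans_map V i x) = truncate_coordinates Is i (g i x)"
      if i: "i \<in> {idx_lo W..<idx_hi W}" and x: "x \<in> carrier (space_at V i)" for i x
    proof -
      have i': "i \<in> {idx_lo W..idx_hi W}" "Suc i \<in> {idx_lo W..idx_hi W}" using i by auto
      have adjoint': "b' i (trans_map W i y) x = b' (Suc i) y (trans_map V i x)"
        if "y \<in> carrier (space_at W (Suc i))" for y
        using adjoint[OF i x that] by (simp add: b'_def)
      show ?thesis unfolding g_def trunc(2)
        by (rule dual_coordinates_natural[where t = "trans_map W i" and s = "trans_map V i",
              OF pairing'[OF i'(2)] pairing'[OF i'(1)]
              iso[OF i'(2)] iso[OF i'(1)] W_closed[OF i] adjoint'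
              natural[OF i, unfolded trunc(2)] x])
    qed
    ultimately show "is_barcode V B"
      unfolding is_barcode_iff using Is by (auto simp: lo hi intro!: exI[of _ Is] exI[of _ g])
  qed
qed

text \<open>\<open>Pers\<close> is a description through \<open>is_barcode\<close>, and the
  preceding equivalence makes the two predicates equal.\<close>

lemma Pers_adjoint:
  assumes "adjoint_modules V W b"
  shows "Pers V = Pers W"
  by (simp only: Pers_def is_barcode_adjoint[OF assms])


section \<open>Pairings of quotient spaces\<close>

lemma (in vector_space) coset_eq_iff:
  assumes "subspace B"
  shows "x +o B = y +o B \<longleftrightarrow> x - y \<in> B"
proof
  assume "x +o B = y +o B"
  then have "x \<in> y +o B"
    using subspace_0[OF assms] by (auto simp: elt_set_plus_def)
  then show "x - y \<in> B" by (auto simp: elt_set_plus_def)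
next
  assume *: "x - y \<in> B"
  have "x + c \<in> y +o B" "y + c \<in> x +o B" if "c \<in> B" for c
    using subspace_add[OF assms * that] subspace_diff[OF assms that *]
    by (auto simp: elt_set_plus_def intro: bexI[of _ "x - y + c"] bexI[of _ "c - (x - y)"])
  then show "x +o B = y +o B" by (auto simp: elt_set_plus_def)
qed

text \<open>\<open>B\<close> is only asked to contain 0, which covers images of subspaces under
  scaling and restriction.\<close>

lemma (in vector_space) subspace_plus_absorb:
  assumes "subspace B'" "B \<subseteq> B'" "0 \<in> B"
  shows "B + B' = B'"
proof
  show "B + B' \<subseteq> B'"
    using assms subspace_add unfolding set_plus_def by blast
  show "B' \<subseteq> B + B'"
    using set_zero_plus2[OF assms(3)] .
qed

lemma (in vector_space) coset_add:
  assumes "subspace B"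
  shows "(x +o B) + (y +o B) = (x + y) +o B"
  by (simp only: set_plus_rearrange subspace_plus_absorb[OF assms order.refl subspace_0[OF assms]])

text \<open>Scaling of cosets and \<open>cohomology_incl\<close> both have this shape: apply
  \<open>f\<close> elementwise, then add the target subspace.\<close>

lemma additive_image_coset:
  fixes f :: "'v::ab_group_add \<Rightarrow> 'w::ab_group_add"
  assumes "\<And>x y. f (x + y) = f x + f y"
  shows "f ` (x +o B) + B' = f x +o (f ` B + B')"
proof -
  have "f ` (x +o B) = f x +o f ` B"
    by (auto simp: elt_set_plus_def image_iff) (metis assms)+
  then show ?thesis by (simp only: set_plus_rearrange3)
qed

definition coset_rep :: "'v::ab_group_add set \<Rightarrow> 'v set \<Rightarrow> 'v set \<Rightarrow> 'v" where
  "coset_rep Z B S = (SOME c. c \<in> Z \<and> S = c +o B)"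

text \<open>Elements of a quotient are sets, so the pairing goes through chosen representatives;
  \<open>quotient_pairing_coset\<close> shows that the choice is harmless.\<close>

definition quotient_pairing ::
    "('v::ab_group_add \<Rightarrow> 'w::ab_group_add \<Rightarrow> 'k) \<Rightarrow> 'v set \<Rightarrow> 'v set \<Rightarrow> 'w set \<Rightarrow> 'w set
      \<Rightarrow> 'v set \<Rightarrow> 'w set \<Rightarrow> 'k" where
  "quotient_pairing ev Z B Z' B' S T = ev (coset_rep Z B S) (coset_rep Z' B' T)"

text \<open>The last four conditions say that \<open>Z \<inter> B\<close> is the annihilator of
  \<open>Z'\<close> in \<open>Z\<close>, and \<open>Z' \<inter> B'\<close> that of \<open>Z\<close>
  in \<open>Z'\<close>, with \<open>B\<close> and \<open>B'\<close> annihilating throughout. The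
  first two let the pairing descend to the quotients, the other two make it nondegenerate.\<close>

locale subquotient_pairing = L: vector_space scl + R: vector_space scr
  for scl :: "'k::field \<Rightarrow> 'v::ab_group_add \<Rightarrow> 'v" and scr :: "'k \<Rightarrow> 'w::ab_group_add \<Rightarrow> 'w" +
  fixes ev :: "'v \<Rightarrow> 'w \<Rightarrow> 'k" and Z B Z' B'
  assumes ev_left: "\<And>y. Vector_Spaces.linear scl (*) (\<lambda>x. ev x y)"
    and ev_right: "\<And>x. Vector_Spaces.linear scr (*) (ev x)"
    and subspaces: "L.subspace Z" "L.subspace B" "R.subspace Z'" "R.subspace B'"
    and annihilates: "x \<in> B \<Longrightarrow> y \<in> Z' \<Longrightarrow> ev x y = 0" "x \<in> Z \<Longrightarrow> y \<in> B' \<Longrightarrow> ev x y = 0"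
    and annihilator_left: "x \<in> Z \<Longrightarrow> (\<And>y. y \<in> Z' \<Longrightarrow> ev x y = 0) \<Longrightarrow> x \<in> B"
    and annihilator_right: "y \<in> Z' \<Longrightarrow> (\<And>x. x \<in> Z \<Longrightarrow> ev x y = 0) \<Longrightarrow> y \<in> B'"
begin

lemma quotient_pairing_coset:
  assumes "x \<in> Z" "y \<in> Z'"
  shows "quotient_pairing ev Z B Z' B' (x +o B) (y +o B') = ev x y"
proof -
  interpret ev_left: Vector_Spaces.linear scl "(*)" "\<lambda>u. ev u v" for v by (rule ev_left)
  interpret ev_right: Vector_Spaces.linear scr "(*)" "ev u" for u by (rule ev_right)
  define x' y' where "x' = coset_rep Z B (x +o B)" and "y' = coset_rep Z' B' (y +o B')"
  have "\<exists>c. c \<in> Z \<and> x +o B = c +o B" "\<exists>c. c \<in> Z' \<and> y +o B' = c +o B'"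
    using assms by blast+
  from this[THEN someI_ex]
  have x': "x' \<in> Z \<and> x +o B = x' +o B" and y': "y' \<in> Z' \<and> y +o B' = y' +o B'"
    by (simp_all only: x'_def y'_def coset_rep_def)
  have "x - x' \<in> B" "y - y' \<in> B'"
    using conjunct2[OF x'] conjunct2[OF y']
    by (simp_all only: L.coset_eq_iff[OF subspaces(2)] R.coset_eq_iff[OF subspaces(4)])
  \<comment> \<open>One representative is replaced at a time:
    \<open>ev x y - ev x' y' = ev (x - x') y' + ev x (y - y')\<close>.\<close>
  then have "ev (x - x') y' = 0" "ev x (y - y') = 0"
    using annihilates x' y' assms by blast+
  then have "ev x y = ev x' y'"
    by (simp add: ev_left.diff ev_right.diff)
  then show ?thesis by (simp add: quotient_pairing_def x'_def y'_def)
qed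

lemma nondegenerate_quotient_pairing:
  "nondegenerate_pairing (quotient_space scl Z B) (quotient_space scr Z' B')
     (quotient_pairing ev Z B Z' B')"
proof -
  interpret ev_left: Vector_Spaces.linear scl "(*)" "\<lambda>u. ev u v" for v by (rule ev_left)
  interpret ev_right: Vector_Spaces.linear scr "(*)" "ev u" for u by (rule ev_right)
  have add: "(x +o B) + (y +o B) = (x + y) +o B" "(z +o B') + (w +o B') = (z + w) +o B'" for x y z w
    by (simp_all add: L.coset_add R.coset_add subspaces)
  \<comment> \<open>For \<open>a = 0\<close> the image of \<open>B\<close> collapses to zero; adding
    \<open>B\<close> restores a full coset.\<close>
  have scl: "scl a ` (x +o B) + B = scl a x +o B" for a x
  proof -
    have "scl a ` B + B = B"
      using L.subspace_scale[OF subspaces(2)] L.subspace_0[OF subspaces(2)]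
      by (intro L.subspace_plus_absorb[OF subspaces(2)]) (auto simp: image_iff intro!: bexI[of _ 0])
    then show ?thesis using additive_image_coset[of "scl a" x B B] by (simp add: L.scale_right_distrib)
  qed
  have scr: "scr a ` (y +o B') + B' = scr a y +o B'" for a y
  proof -
    have "scr a ` B' + B' = B'"
      using R.subspace_scale[OF subspaces(4)] R.subspace_0[OF subspaces(4)]
      by (intro R.subspace_plus_absorb[OF subspaces(4)]) (auto simp: image_iff intro!: bexI[of _ 0])
    then show ?thesis using additive_image_coset[of "scr a" y B' B'] by (simp add: R.scale_right_distrib)
  qed
  note closed = L.subspace_add[OF subspaces(1)] R.subspace_add[OF subspaces(3)]
    L.subspace_scale[OF subspaces(1)] R.subspace_scale[OF subspaces(3)]
  note pairing = quotient_pairing_coset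
  have sep_left: "x +o B = x' +o B"
    if x: "x \<in> Z" "x' \<in> Z" and eq: "\<And>y. y \<in> Z' \<Longrightarrow> ev x y = ev x' y" for x x'
    unfolding L.coset_eq_iff[OF subspaces(2)]
    using L.subspace_diff[OF subspaces(1) x] eq by (auto intro!: annihilator_left simp: ev_left.diff)
  have sep_right: "y +o B' = y' +o B'"
    if y: "y \<in> Z'" "y' \<in> Z'" and eq: "\<And>x. x \<in> Z \<Longrightarrow> ev x y = ev x y'" for y y'
    unfolding R.coset_eq_iff[OF subspaces(4)]
    using R.subspace_diff[OF subspaces(3) y] eq by (auto intro!: annihilator_right simp: ev_right.diff)
  have zero: "B \<in> (\<lambda>z. z +o B) ` Z" "B' \<in> (\<lambda>z. z +o B') ` Z'"
    using L.subspace_0[OF subspaces(1)] R.subspace_0[OF subspaces(3)]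
    by (auto intro!: image_eqI[of _ _ 0])
  have sep_left': "S = S'"
    if S: "S \<in> (\<lambda>z. z +o B) ` Z" "S' \<in> (\<lambda>z. z +o B) ` Z"
      and eq: "\<And>T. T \<in> (\<lambda>z. z +o B') ` Z' \<Longrightarrow>
        quotient_pairing ev Z B Z' B' S T = quotient_pairing ev Z B Z' B' S' T" for S S'
  proof -
    obtain x x' where x: "x \<in> Z" "x' \<in> Z" and SS': "S = x +o B" "S' = x' +o B"
      using S by blast
    have "ev x y = ev x' y" if y: "y \<in> Z'" for y
      using eq[OF imageI[OF y]] by (simp only: SS' pairing x y)
    with x have "x +o B = x' +o B" by (rule sep_left)
    then show ?thesis by (simp only: SS')
  qed
  have sep_right': "T = T'"
    if T: "T \<in> (\<lambda>z. z +o B') ` Z'" "T' \<in> (\<lambda>z. z +o B') ` Z'"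
      and eq: "\<And>S. S \<in> (\<lambda>z. z +o B) ` Z \<Longrightarrow>
        quotient_pairing ev Z B Z' B' S T = quotient_pairing ev Z B Z' B' S T'" for T T'
  proof -
    obtain y y' where y: "y \<in> Z'" "y' \<in> Z'" and TT': "T = y +o B'" "T' = y' +o B'"
      using T by blast
    have "ev x y = ev x y'" if x: "x \<in> Z" for x
      using eq[OF imageI[OF x]] by (simp only: TT' pairing x y)
    with y have "y +o B' = y' +o B'" by (rule sep_right)
    then show ?thesis by (simp only: TT')
  qed
  have V: "carrier (quotient_space scl Z B) = (\<lambda>z. z +o B) ` Z"
      "\<zero>\<^bsub>quotient_space scl Z B\<^esub> = B"
      "S \<oplus>\<^bsub>quotient_space scl Z B\<^esub> S' = S + S'"
      "a \<odot>\<^bsub>quotient_space scl Z B\<^esub> S = scl a ` S + B" for S S' a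
    by (simp_all add: quotient_space_def)
  have W: "carrier (quotient_space scr Z' B') = (\<lambda>z. z +o B') ` Z'"
      "\<zero>\<^bsub>quotient_space scr Z' B'\<^esub> = B'"
      "T \<oplus>\<^bsub>quotient_space scr Z' B'\<^esub> T' = T + T'"
      "a \<odot>\<^bsub>quotient_space scr Z' B'\<^esub> T = scr a ` T + B'" for T T' a
    by (simp_all add: quotient_space_def)
  show ?thesis
    unfolding nondegenerate_pairing_def V W
    by (intro conjI allI impI; 
          (rule sep_left', assumption, assumption, blast |
           rule sep_right', assumption, assumption, blast)?)
      (use zero in \<open>auto simp: add scl scr closed pairing
        ev_left.add ev_right.add ev_left.scale ev_right.scale\<close>)
qed

end


section \<open>Pairing of singular homology and cohomology\<close>

lemma lookup_chain_scale [simp]: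
  "Poly_Mapping.lookup (Poly_Mapping.map ((*) (a::'k::field)) c) \<sigma> = a * Poly_Mapping.lookup c \<sigma>"
  by (simp add: Poly_Mapping.map.rep_eq when_def)

interpretation chain_space: vector_space "\<lambda>a::'k::field. Poly_Mapping.map ((*) a) :: ('b \<Rightarrow>\<^sub>0 'k) \<Rightarrow> _"
  by unfold_locales (rule poly_mapping_eqI, simp only: lookup_chain_scale lookup_add
      distrib_left distrib_right mult.assoc mult_1_left)+

definition evaluate :: "('b \<Rightarrow>\<^sub>0 'k::field) \<Rightarrow> ('b \<Rightarrow> 'k) \<Rightarrow> 'k" where
  "evaluate c \<phi> = (\<Sum>\<sigma>\<in>Poly_Mapping.keys c. Poly_Mapping.lookup c \<sigma> * \<phi> \<sigma>)"

lemma sum_keys_superset: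
  assumes "finite K" "Poly_Mapping.keys c \<subseteq> K" "\<And>\<sigma>. f \<sigma> 0 = 0"
  shows "(\<Sum>\<sigma>\<in>Poly_Mapping.keys c. f \<sigma> (Poly_Mapping.lookup c \<sigma>)) =
    (\<Sum>\<sigma>\<in>K. f \<sigma> (Poly_Mapping.lookup c \<sigma>))"
  using assms by (intro sum.mono_neutral_left) (auto simp: in_keys_iff)

text \<open>Evaluation and boundary are both sums over the support, which can shrink under addition
  and scaling; as \<open>f \<sigma> 0 = 0\<close>, the lost simplices contribute nothing.\<close>

lemma linear_sum_keys:
  fixes f :: "'b \<Rightarrow> 'k::field \<Rightarrow> 'v::ab_group_add" and scale :: "'k \<Rightarrow> 'v \<Rightarrow> 'v"
  assumes V: "vector_space scale"
    and add: "\<And>\<sigma> a b. f \<sigma> (a + b) = f \<sigma> a + f \<sigma> b"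
    and smult: "\<And>\<sigma> a b. f \<sigma> (a * b) = scale a (f \<sigma> b)"
  shows "Vector_Spaces.linear (\<lambda>a. Poly_Mapping.map ((*) a)) scale
    (\<lambda>c. \<Sum>\<sigma>\<in>Poly_Mapping.keys c. f \<sigma> (Poly_Mapping.lookup c \<sigma>))"
proof -
  interpret V: vector_space scale by (rule V)
  have f0: "f \<sigma> 0 = 0" for \<sigma> using add[of \<sigma> 0 0] by simp
  show ?thesis
  proof unfold_locales
    show "(\<Sum>\<sigma>\<in>Poly_Mapping.keys (c + d). f \<sigma> (Poly_Mapping.lookup (c + d) \<sigma>)) =
        (\<Sum>\<sigma>\<in>Poly_Mapping.keys c. f \<sigma> (Poly_Mapping.lookup c \<sigma>)) +
        (\<Sum>\<sigma>\<in>Poly_Mapping.keys d. f \<sigma> (Poly_Mapping.lookup d \<sigma>))" for c d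
      by (rule setsum_keys_plus_distrib) (simp_all add: f0 add)
    show "(\<Sum>\<sigma>\<in>Poly_Mapping.keys (Poly_Mapping.map ((*) a) c).
          f \<sigma> (Poly_Mapping.lookup (Poly_Mapping.map ((*) a) c) \<sigma>)) =
        scale a (\<Sum>\<sigma>\<in>Poly_Mapping.keys c. f \<sigma> (Poly_Mapping.lookup c \<sigma>))" for a c
    proof -
      have "Poly_Mapping.keys (Poly_Mapping.map ((*) a) c) \<subseteq> Poly_Mapping.keys c"
        by (auto simp: in_keys_iff)
      then show ?thesis
        by (subst sum_keys_superset[of "Poly_Mapping.keys c"]) (auto simp: f0 smult V.scale_sum_right)
    qed
  qed
qed

lemma linear_evaluate_left: "Vector_Spaces.linear (\<lambda>a. Poly_Mapping.map ((*) a)) (*) (\<lambda>c. evaluate c \<phi>)"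
  unfolding evaluate_def
  by (rule linear_sum_keys[where f = "\<lambda>\<sigma> a. a * \<phi> \<sigma>"])
    (unfold_locales, simp_all add: algebra_simps)

lemma linear_evaluate_right: "Vector_Spaces.linear (\<lambda>a \<phi> \<sigma>. a * \<phi> \<sigma>) (*) (evaluate c)"
  by unfold_locales (simp_all add: evaluate_def algebra_simps sum.distrib sum_distrib_left)

interpretation evaluate_left: Vector_Spaces.linear
  "\<lambda>a. Poly_Mapping.map ((*) a)" "(*)" "\<lambda>c. evaluate c \<phi>" for \<phi> :: "'b \<Rightarrow> 'k::field"
  by (rule linear_evaluate_left)

interpretation evaluate_right: Vector_Spaces.linear
  "\<lambda>a \<phi> \<sigma>. a * \<phi> \<sigma>" "(*)" "evaluate c" for c :: "'b \<Rightarrow>\<^sub>0 'k::field"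
  by (rule linear_evaluate_right)

lemma linear_fboundary:
  "Vector_Spaces.linear (\<lambda>a. Poly_Mapping.map ((*) a)) (\<lambda>a. Poly_Mapping.map ((*) a))
     (fboundary p :: ('k::field, 'a) fchain \<Rightarrow> _)"
proof (cases "p = 0")
  case True
  then have "fboundary p = (\<lambda>c::('k, 'a) fchain. 0)" by (simp add: fboundary_def fun_eq_iff)
  then show ?thesis by (simp only:) (unfold_locales, simp_all)
next
  case False
  then have "(fboundary p :: ('k, 'a) fchain \<Rightarrow> _) = (\<lambda>c. \<Sum>\<sigma>\<in>Poly_Mapping.keys c. \<Sum>i\<le>p.
      Poly_Mapping.single (singular_face p i \<sigma>) ((-1) ^ i * Poly_Mapping.lookup c \<sigma>))"
    by (simp add: fboundary_def fun_eq_iff)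
  moreover have "Vector_Spaces.linear (\<lambda>a. Poly_Mapping.map ((*) a)) (\<lambda>a. Poly_Mapping.map ((*) a))
     (\<lambda>c::('k, 'a) fchain. \<Sum>\<sigma>\<in>Poly_Mapping.keys c. \<Sum>i\<le>p.
      Poly_Mapping.single (singular_face p i \<sigma>) ((-1) ^ i * Poly_Mapping.lookup c \<sigma>))"
    by (rule linear_sum_keys[where
          f = "\<lambda>\<sigma> a. \<Sum>i\<le>p. Poly_Mapping.single (singular_face p i \<sigma>) ((-1) ^ i * a)"])
      (unfold_locales, simp_all add: chain_space.scale_sum_right single_add algebra_simps sum.distrib)
  ultimately show ?thesis by simp
qed

interpretation fboundary: Vector_Spaces.linear
  "\<lambda>a. Poly_Mapping.map ((*) a)" "\<lambda>a. Poly_Mapping.map ((*) a)"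
  "fboundary p :: ('k::field, 'a) fchain \<Rightarrow> ('k, 'a) fchain" for p
  by (rule linear_fboundary)

lemma evaluate_single [simp]: "evaluate (Poly_Mapping.single \<sigma> a) \<phi> = a * \<phi> \<sigma>"
  by (simp add: evaluate_def)

lemma evaluate_zero_on_keys:
  "(\<And>\<sigma>. \<sigma> \<in> Poly_Mapping.keys c \<Longrightarrow> \<phi> \<sigma> = 0) \<Longrightarrow> evaluate c \<phi> = 0"
  by (simp add: evaluate_def)

section \<open>Boundary and coboundary as transposes; cochains from functionals\<close>

lemma subspace_fchains:
  fixes X :: "'a topology"
  shows "chain_space.subspace (fchains p X :: ('k::field, 'a) fchain set)"
proof (rule chain_space.subspaceI)
  show "c + d \<in> fchains p X" if "c \<in> fchains p X" "d \<in> fchains p X" for c d :: "('k, 'a) fchain"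
    using that keys_add[of c d] by (auto simp: fchains_def)
qed (auto simp: fchains_def in_keys_iff)

lemma single_in_fchains: "singular_simplex p X \<sigma> \<Longrightarrow> Poly_Mapping.single \<sigma> a \<in> fchains p X"
  by (simp add: fchains_def)

lemma fboundary_in_fchains:
  assumes "c \<in> fchains (Suc p) X"
  shows "fboundary (Suc p) c \<in> fchains p X"
proof -
  have "singular_simplex p X (singular_face (Suc p) i \<sigma>)"
    if "\<sigma> \<in> Poly_Mapping.keys c" "i \<le> Suc p" for \<sigma> i
    using assms that singular_simplex_singular_face[of "Suc p" X \<sigma> i] by (auto simp: fchains_def)
  then show ?thesis
    unfolding fboundary_def if_not_P[OF nat.distinct(2)]
    by (intro chain_space.subspace_sum[OF subspace_fchains] single_in_fchains) auto
qed

text \<open>Boundary and coboundary carry the same alternating signs, so they are transposes without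
  an extra sign. As \<open>coboundary p X\<close> is cut off outside \<open>X\<close>, the chain
  \<open>c\<close> has to lie in \<open>X\<close>.\<close>

lemma evaluate_fboundary:
  assumes "c \<in> fchains (Suc p) X"
  shows "evaluate (fboundary (Suc p) c) \<phi> = evaluate c (coboundary p X \<phi>)"
proof -
  have "evaluate (fboundary (Suc p) c) \<phi> = (\<Sum>\<sigma>\<in>Poly_Mapping.keys c. \<Sum>i\<le>Suc p.
      (-1) ^ i * Poly_Mapping.lookup c \<sigma> * \<phi> (singular_face (Suc p) i \<sigma>))"
    by (simp only: fboundary_def evaluate_left.sum evaluate_single nat.distinct if_False)
  also have "\<dots> = evaluate c (coboundary p X \<phi>)"
    unfolding evaluate_def
  proof (rule sum.cong[OF refl])
    fix \<sigma> assume "\<sigma> \<in> Poly_Mapping.keys c"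
    then have "singular_simplex (Suc p) X \<sigma>" using assms by (auto simp: fchains_def)
    then show "(\<Sum>i\<le>Suc p. (-1) ^ i * Poly_Mapping.lookup c \<sigma> * \<phi> (singular_face (Suc p) i \<sigma>)) =
        Poly_Mapping.lookup c \<sigma> * coboundary p X \<phi> \<sigma>"
      by (simp only: coboundary_def if_True sum_distrib_left mult_ac)
  qed
  finally show ?thesis .
qed

text \<open>Normalizes an abstract functional to a cochain, so that the functionals produced by
  linear algebra can be used; on chains of \<open>X\<close> nothing is lost.\<close>

definition cochain_of ::
    "nat \<Rightarrow> 'a topology \<Rightarrow> (('k::field, 'a) fchain \<Rightarrow> 'k) \<Rightarrow> ('k, 'a) cochain" where
  "cochain_of p X f = (\<lambda>\<sigma>. if singular_simplex p X \<sigma> then f (Poly_Mapping.single \<sigma> 1) else 0)"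

lemma evaluate_cochain_of:
  assumes f: "Vector_Spaces.linear (\<lambda>a. Poly_Mapping.map ((*) a)) (*) f" and c: "c \<in> fchains p X"
  shows "evaluate c (cochain_of p X f) = f c"
proof -
  interpret f: Vector_Spaces.linear "\<lambda>a. Poly_Mapping.map ((*) a)" "(*)" f by (rule f)
  have "c = (\<Sum>\<sigma>\<in>Poly_Mapping.keys c. Poly_Mapping.map ((*) (Poly_Mapping.lookup c \<sigma>))
      (Poly_Mapping.single \<sigma> 1))"
    by (rule poly_mapping_eqI) (auto simp: lookup_sum lookup_single when_def in_keys_iff if_distrib cong: if_cong)
  then have "f c = (\<Sum>\<sigma>\<in>Poly_Mapping.keys c. Poly_Mapping.lookup c \<sigma> * f (Poly_Mapping.single \<sigma> 1))"
    by (metis (no_types, lifting) f.sum f.scale sum.cong)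
  also have "\<dots> = evaluate c (cochain_of p X f)"
    unfolding evaluate_def by (rule sum.cong) (use c in \<open>auto simp: cochain_of_def fchains_def\<close>)
  finally show ?thesis by simp
qed

lemma cochain_of_in_cochains:
  assumes "\<And>c. c \<in> fchains p (subtopology X A) \<Longrightarrow> f c = 0"
  shows "cochain_of p X f \<in> cochains p X A"
  using assms by (auto simp: cochains_def cochain_of_def intro: single_in_fchains)

text \<open>With the alternating sum hidden in the boundary, linearity and vanishing of coboundaries
  follow without handling signs.\<close>

lemma coboundary_conv_evaluate:
  "coboundary p X \<phi> =
     (\<lambda>\<sigma>. if singular_simplex (Suc p) X \<sigma>
           then evaluate (fboundary (Suc p) (Poly_Mapping.single \<sigma> 1)) \<phi> else 0)"
proof
  fix \<sigma>
  show "coboundary p X \<phi> \<sigma> = (if singular_simplex (Suc p) X \<sigma>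
      then evaluate (fboundary (Suc p) (Poly_Mapping.single \<sigma> 1)) \<phi> else 0)"
    by (cases "singular_simplex (Suc p) X \<sigma>")
      (simp_all add: evaluate_fboundary[OF single_in_fchains, where X = X],
       simp add: coboundary_def)
qed

lemma cochains_vanish:
  "\<phi> \<in> cochains p X A \<Longrightarrow> c \<in> fchains p (subtopology X A) \<Longrightarrow> evaluate c \<phi> = 0"
  by (rule evaluate_zero_on_keys) (auto simp: cochains_def fchains_def)

lemma fchains_mono:
  "(\<And>\<sigma>. singular_simplex p X \<sigma> \<Longrightarrow> singular_simplex p Y \<sigma>) \<Longrightarrow> fchains p X \<subseteq> fchains p Y"
  by (auto simp: fchains_def)

lemma subspace_frelcycles: "chain_space.subspace (frelcycles p X A)"
  unfolding frelcycles_def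
  using chain_space.subspace_inter[OF subspace_fchains
      fboundary.subspace_vimage[OF subspace_fchains]]
  by (auto simp: Int_def vimage_def)

lemma subspace_frelboundaries:
  fixes X :: "'a topology"
  shows "chain_space.subspace (frelboundaries p X A :: ('k::field, 'a) fchain set)"
proof -
  have "(frelboundaries p X A :: ('k, 'a) fchain set) = {c + d |c d. c \<in> fboundary (Suc p) ` fchains (Suc p) X \<and>
      d \<in> fchains p (subtopology X A)}"
    by (auto simp: frelboundaries_def set_plus_def)
  then show ?thesis
    by (simp only: chain_space.subspace_sums[OF fboundary.subspace_image[OF subspace_fchains]
          subspace_fchains])
qed

lemma subspace_cochains: "fun_space.subspace (cochains p X A)"
  by (rule fun_space.subspaceI) (auto simp: cochains_def)

lemma linear_coboundary:
  "Vector_Spaces.linear (\<lambda>a \<phi> \<sigma>. a * \<phi> \<sigma>) (\<lambda>a \<phi> \<sigma>. a * \<phi> \<sigma>)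
     (coboundary p X :: ('k::field, 'a) cochain \<Rightarrow> _)"
  by unfold_locales
    (auto simp: coboundary_conv_evaluate fun_eq_iff evaluate_right.add evaluate_right.scale)

interpretation coboundary: Vector_Spaces.linear
  "\<lambda>a \<phi> \<sigma>. a * \<phi> \<sigma>" "\<lambda>a \<phi> \<sigma>. a * \<phi> \<sigma>"
  "coboundary p X :: ('k::field, 'a) cochain \<Rightarrow> ('k, 'a) cochain" for p X
  by (rule linear_coboundary)

lemma subspace_cocycles: "fun_space.subspace (cocycles p X A)"
  unfolding cocycles_def
  using fun_space.subspace_inter[OF subspace_cochains coboundary.subspace_kernel]
  by (auto simp: Int_def)

lemma subspace_coboundaries: "fun_space.subspace (coboundaries p X A)"
  by (cases p) (simp_all add: coboundaries_def fun_space.subspace_single_0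
      coboundary.subspace_image subspace_cochains)

section \<open>Mutual annihilators: cycles and boundaries, cocycles and coboundaries\<close>

lemma evaluate_boundary_cocycle:
  assumes "c \<in> frelboundaries p X A" "\<phi> \<in> cocycles p X A"
  shows "evaluate c \<phi> = 0"
proof -
  obtain d a where "d \<in> fchains (Suc p) X" "a \<in> fchains p (subtopology X A)"
      "c = fboundary (Suc p) d + a"
    using assms(1) by (auto simp: frelboundaries_def set_plus_def)
  moreover have "\<phi> \<in> cochains p X A" "evaluate d (coboundary p X \<phi>) = 0" for d
    using assms(2) by (simp_all add: cocycles_def evaluate_right.zero)
  ultimately show ?thesis
    using cochains_vanish evaluate_fboundary by (metis add_0 evaluate_left.add)
qed

text \<open>The boundary of a relative cycle lies in \<open>A\<close>, where a relative cochain
  vanishes.\<close>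

lemma evaluate_cycle_coboundary:
  assumes "c \<in> frelcycles p X A" "\<phi> \<in> coboundaries p X A"
  shows "evaluate c \<phi> = 0"
proof (cases p)
  case 0
  then show ?thesis using assms(2) by (simp add: coboundaries_def evaluate_right.zero)
next
  case (Suc q)
  then obtain \<psi> where \<psi>: "\<psi> \<in> cochains q X A" "\<phi> = coboundary q X \<psi>"
    using assms(2) by (auto simp: coboundaries_def)
  have "c \<in> fchains (Suc q) X" "fboundary (Suc q) c \<in> fchains q (subtopology X A)"
    using assms(1) Suc by (auto simp: frelcycles_def)
  then show ?thesis using \<psi> evaluate_fboundary cochains_vanish by metis
qed

text \<open>A functional separating \<open>c\<close> from the relative boundaries would itself be a
  relative cocycle: it kills the chains of \<open>A\<close>, so it is a cochain of the pair, and it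
  kills boundaries, so its coboundary is zero. Yet its value on \<open>c\<close> is 1.\<close>

lemma frelboundary_if_annihilated:
  assumes ann: "\<And>\<phi>. \<phi> \<in> cocycles p X A \<Longrightarrow> evaluate c \<phi> = 0" and c: "c \<in> frelcycles p X A"
  shows "c \<in> frelboundaries p X A"
proof (rule ccontr)
  assume "c \<notin> frelboundaries p X A"
  then obtain f where f: "Vector_Spaces.linear (\<lambda>a. Poly_Mapping.map ((*) a)) (*) f" "f c = 1"
      "\<forall>d\<in>frelboundaries p X A. f d = 0"
    using chain_space.separating_functional[OF subspace_frelboundaries] by blast
  have bd: "f (fboundary (Suc p) d) = 0" if "d \<in> fchains (Suc p) X" for d
  proof -
    have "fboundary (Suc p) d + 0 \<in> frelboundaries p X A"
      unfolding frelboundaries_def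
      using that chain_space.subspace_0[OF subspace_fchains] by (intro set_plus_intro) auto
    with f(3) show ?thesis by simp
  qed
  have A: "f d = 0" if "d \<in> fchains p (subtopology X A)" for d
  proof -
    have "fboundary (Suc p) 0 + d \<in> frelboundaries p X A"
      unfolding frelboundaries_def
      using that chain_space.subspace_0[OF subspace_fchains] by (intro set_plus_intro imageI)
    with f(3) show ?thesis by (simp add: fboundary.zero)
  qed
  have "coboundary p X (cochain_of p X f) = 0"
    by (auto simp: coboundary_conv_evaluate fun_eq_iff evaluate_cochain_of[OF f(1)]
        fboundary_in_fchains single_in_fchains bd)
  with A have "cochain_of p X f \<in> cocycles p X A"
    by (simp add: cocycles_def cochain_of_in_cochains)
  then have "f c = 0"
    using ann c evaluate_cochain_of[OF f(1), of c p X] by (auto simp: frelcycles_def)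
  with f(2) show False by simp
qed

text \<open>Relative cycles are the chains whose boundary lies in \<open>A\<close>. In positive
  degree, a cocycle vanishing on them factors through the boundary by a functional that kills the
  chains of \<open>A\<close>, and this functional is the cochain whose coboundary is sought.\<close>

lemma coboundary_if_annihilates:
  fixes X :: "'a topology" and \<phi> :: "('k::field, 'a) cochain"
  assumes ann: "\<And>c. c \<in> frelcycles p X A \<Longrightarrow> evaluate c \<phi> = 0" and \<phi>: "\<phi> \<in> cocycles p X A"
  shows "\<phi> \<in> coboundaries p X A"
proof (cases p)
  case 0
  have "\<phi> \<sigma> = 0" for \<sigma>
  proof (cases "singular_simplex p X \<sigma>")
    case True
    \<comment> \<open>In degree 0 the boundary is the zero chain, so every singular 0-simplex is a
      relative cycle.\<close>
    then have "Poly_Mapping.single \<sigma> 1 \<in> frelcycles p X A"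
      using 0 by (simp add: frelcycles_def single_in_fchains fboundary_def
          chain_space.subspace_0[OF subspace_fchains])
    from ann[OF this] show ?thesis by simp
  next
    case False
    with \<phi> show ?thesis by (simp add: cocycles_def cochains_def)
  qed
  then show ?thesis using 0 by (auto simp: coboundaries_def)
next
  case (Suc q)
  interpret P: vector_space_pair "\<lambda>a::'k. Poly_Mapping.map ((*) a) :: ('k, 'a) fchain \<Rightarrow> _"
    "\<lambda>a::'k. Poly_Mapping.map ((*) a) :: ('k, 'a) fchain \<Rightarrow> _" ..
  obtain \<psi> where \<psi>: "Vector_Spaces.linear (\<lambda>a. Poly_Mapping.map ((*) a)) (*) \<psi>"
      "\<forall>c\<in>fchains p X. \<psi> (fboundary p c) = evaluate c \<phi>"
      "\<forall>c\<in>fchains q (subtopology X A). \<psi> c = 0"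
    using P.functional_factors[OF linear_fboundary[of p] subspace_fchains[of p X]
        subspace_fchains[of q "subtopology X A"] linear_evaluate_left[of \<phi>]] ann Suc
    by (auto simp: frelcycles_def)
  have "\<phi> \<sigma> = coboundary q X (cochain_of q X \<psi>) \<sigma>" for \<sigma>
  proof (cases "singular_simplex p X \<sigma>")
    case True
    have "\<psi> (fboundary p (Poly_Mapping.single \<sigma> 1)) = \<phi> \<sigma>"
      using bspec[OF \<psi>(2) single_in_fchains[OF True, of 1]] by simp
    with True Suc show ?thesis
      by (simp add: coboundary_conv_evaluate evaluate_cochain_of[OF \<psi>(1)]
          fboundary_in_fchains single_in_fchains)
  next
    case False
    with \<phi> Suc show ?thesis by (simp add: cocycles_def cochains_def coboundary_def)
  qed
  then have "\<phi> = coboundary q X (cochain_of q X \<psi>)" by blast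
  moreover have "cochain_of q X \<psi> \<in> cochains q X A"
    using \<psi>(3) by (intro cochain_of_in_cochains) blast
  ultimately show ?thesis using Suc by (simp add: coboundaries_def)
qed

interpretation singular_pairing: subquotient_pairing
  "\<lambda>a. Poly_Mapping.map ((*) a)" "\<lambda>a \<phi> \<sigma>. a * \<phi> \<sigma>" "evaluate :: ('k::field, 'a) fchain \<Rightarrow> _"
  "frelcycles p X A" "frelboundaries p X A" "cocycles p X A" "coboundaries p X A" for p X A
  by unfold_locales
    (auto intro: linear_evaluate_left linear_evaluate_right subspace_frelcycles
      subspace_frelboundaries subspace_cocycles subspace_coboundaries evaluate_boundary_cocycle
      evaluate_cycle_coboundary frelboundary_if_annihilated coboundary_if_annihilates)

section \<open>The pairing on (co)homology and its adjointness under inclusions of pairs\<close>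

definition homology_pairing ::
    "nat \<Rightarrow> 'a topology \<Rightarrow> 'a set
      \<Rightarrow> ('k::field, 'a) fchain set \<Rightarrow> ('k, 'a) cochain set \<Rightarrow> 'k" where
  "homology_pairing p X A = quotient_pairing evaluate
     (frelcycles p X A) (frelboundaries p X A) (cocycles p X A) (coboundaries p X A)"

lemma nondegenerate_homology_pairing:
  "nondegenerate_pairing (homology p X A) (cohomology p X A) (homology_pairing p X A)"
  unfolding homology_def cohomology_def homology_pairing_def
  by (rule singular_pairing.nondegenerate_quotient_pairing)

lemma carrier_homology:
  "carrier (homology p X A) = (\<lambda>c. c +o frelboundaries p X A) ` frelcycles p X A"
  by (simp add: homology_def quotient_space_def)

lemma carrier_cohomology:
  "carrier (cohomology p X A) = (\<lambda>\<phi>. \<phi> +o coboundaries p X A) ` cocycles p X A"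
  by (simp add: cohomology_def quotient_space_def)

text \<open>Phrased through singular simplices, this covers both the inclusion of one stage in the
  next and the growth of the subspace in a fixed ambient space.\<close>

locale inclusion_of_pairs =
  fixes X :: "'a topology" and A :: "'a set" and Y :: "'a topology" and C :: "'a set"
  assumes simplices: "singular_simplex p X \<sigma> \<Longrightarrow> singular_simplex p Y \<sigma>"
    and subspace_simplices:
      "singular_simplex p (subtopology X A) \<sigma> \<Longrightarrow> singular_simplex p (subtopology Y C) \<sigma>"
begin

text \<open>The pullback of a cochain: the cutoff reestablishes the normalization to 0 off the
  simplices of the smaller space.\<close>

definition restrict_cochain :: "nat \<Rightarrow> ('k::field, 'a) cochain \<Rightarrow> ('k, 'a) cochain" where
  "restrict_cochain p \<phi> = (\<lambda>\<sigma>. if singular_simplex p X \<sigma> then \<phi> \<sigma> else 0)"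

lemma fchains_incl:
  "c \<in> fchains p X \<Longrightarrow> c \<in> fchains p Y"
  "c \<in> fchains p (subtopology X A) \<Longrightarrow> c \<in> fchains p (subtopology Y C)"
  using fchains_mono simplices subspace_simplices by blast+

lemma frelcycles_incl: "c \<in> frelcycles p X A \<Longrightarrow> c \<in> frelcycles p Y C"
  by (simp add: frelcycles_def fchains_incl)

lemma frelboundaries_incl: "frelboundaries p X A \<subseteq> frelboundaries p Y C"
  unfolding frelboundaries_def by (intro set_plus_mono2 image_mono) (auto simp: fchains_incl)

lemma evaluate_restrict: "c \<in> fchains p X \<Longrightarrow> evaluate c (restrict_cochain p \<phi>) = evaluate c \<phi>"
  unfolding evaluate_def by (rule sum.cong) (auto simp: restrict_cochain_def fchains_def)

text \<open>Faces of a simplex of \<open>X\<close> are simplices of \<open>X\<close>, so the cutoff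
  does not reach the faces that occur.\<close>

lemma coboundary_restrict:
  "coboundary p X (restrict_cochain p \<phi>) = restrict_cochain (Suc p) (coboundary p Y \<phi>)"
proof
  fix \<sigma>
  show "coboundary p X (restrict_cochain p \<phi>) \<sigma> = restrict_cochain (Suc p) (coboundary p Y \<phi>) \<sigma>"
    using singular_simplex_singular_face[of "Suc p" X \<sigma>]
    by (auto simp: coboundary_def restrict_cochain_def simplices intro!: sum.cong)
qed

lemma restrict_cochains: "\<phi> \<in> cochains p Y C \<Longrightarrow> restrict_cochain p \<phi> \<in> cochains p X A"
  by (auto simp: cochains_def restrict_cochain_def subspace_simplices)

lemma restrict_cocycles: "\<phi> \<in> cocycles p Y C \<Longrightarrow> restrict_cochain p \<phi> \<in> cocycles p X A"
  by (auto simp: cocycles_def coboundary_restrict restrict_cochains)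
    (simp add: restrict_cochain_def fun_eq_iff)

lemma restrict_coboundaries: "restrict_cochain p ` coboundaries p Y C \<subseteq> coboundaries p X A"
proof (cases p)
  case 0
  then show ?thesis by (auto simp: coboundaries_def restrict_cochain_def fun_eq_iff)
next
  case (Suc q)
  then show ?thesis
    using restrict_cochains
    by (auto simp: coboundaries_def simp flip: coboundary_restrict intro!: imageI)
qed

text \<open>Inclusion leaves the cycle itself alone; the larger space of boundaries absorbs the
  smaller one.\<close>

lemma homology_incl_coset:
  "homology_incl p Y C (c +o frelboundaries p X A) = c +o frelboundaries p Y C"
  unfolding homology_incl_def set_plus_rearrange3
  by (simp only: chain_space.subspace_plus_absorb[OF subspace_frelboundaries frelboundaries_incl
        chain_space.subspace_0[OF subspace_frelboundaries]])

lemma cohomology_incl_coset: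
  "cohomology_incl p X A (\<phi> +o coboundaries p Y C) = restrict_cochain p \<phi> +o coboundaries p X A"
proof -
  have "cohomology_incl p X A (\<phi> +o coboundaries p Y C) =
      restrict_cochain p ` (\<phi> +o coboundaries p Y C) + coboundaries p X A"
    by (simp add: cohomology_incl_def restrict_cochain_def[abs_def])
  also have "\<dots> = restrict_cochain p \<phi> +o
      (restrict_cochain p ` coboundaries p Y C + coboundaries p X A)"
    by (rule additive_image_coset) (simp add: restrict_cochain_def fun_eq_iff)
  also have "restrict_cochain p ` coboundaries p Y C + coboundaries p X A = coboundaries p X A"
  proof (rule fun_space.subspace_plus_absorb[OF subspace_coboundaries restrict_coboundaries])
    have "restrict_cochain p 0 = 0" by (simp add: restrict_cochain_def fun_eq_iff)
    then show "0 \<in> restrict_cochain p ` coboundaries p Y C"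
      using fun_space.subspace_0[OF subspace_coboundaries] by (metis imageI)
  qed
  finally show ?thesis .
qed

lemma homology_incl_carrier:
  "S \<in> carrier (homology p X A) \<Longrightarrow> homology_incl p Y C S \<in> carrier (homology p Y C)"
  by (auto simp: carrier_homology homology_incl_coset frelcycles_incl)

lemma cohomology_incl_carrier:
  "T \<in> carrier (cohomology p Y C) \<Longrightarrow> cohomology_incl p X A T \<in> carrier (cohomology p X A)"
  by (auto simp: carrier_cohomology cohomology_incl_coset restrict_cocycles)

text \<open>For representatives \<open>c\<close> and \<open>\<phi>\<close> both sides are
  \<open>evaluate c \<phi>\<close>: inclusion leaves \<open>c\<close> unchanged, and restriction
  alters \<open>\<phi>\<close> only off the simplices of \<open>X\<close>.\<close>

lemma homology_pairing_adjoint: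
  assumes "S \<in> carrier (homology p X A)" "T \<in> carrier (cohomology p Y C)"
  shows "homology_pairing p Y C (homology_incl p Y C S) T =
    homology_pairing p X A S (cohomology_incl p X A T)"
proof -
  obtain c \<phi> where c: "c \<in> frelcycles p X A" "S = c +o frelboundaries p X A"
    and \<phi>: "\<phi> \<in> cocycles p Y C" "T = \<phi> +o coboundaries p Y C"
    using assms by (auto simp: carrier_homology carrier_cohomology)
  have "c \<in> fchains p X" using c by (simp add: frelcycles_def)
  then show ?thesis
    unfolding homology_pairing_def c(2) \<phi>(2) homology_incl_coset cohomology_incl_coset
    by (simp only: singular_pairing.quotient_pairing_coset frelcycles_incl restrict_cocycles c(1) \<phi>(1)
        evaluate_restrict)
qed

end

section \<open>Absolute and relative modules of a filtration\<close>

lemma filtered_cell_complex_mono: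
  assumes "filtered_cell_complex X n A" "i < n"
  shows "A i \<subseteq> A (Suc i)"
proof -
  have "Suc i \<in> {1..n}" using assms(2) by simp
  then show ?thesis
    using assms(1) unfolding filtered_cell_complex_def attaches_cell_def by fastforce
qed

lemma adjoint_abs_pers:
  assumes "filtered_cell_complex X n A"
  shows "adjoint_modules (abs_homology_pers k X n A) (abs_cohomology_pers k X n A)
    (\<lambda>i. homology_pairing k (subtopology X (A i)) {})"
proof -
  have incl: "inclusion_of_pairs (subtopology X (A i)) {} (subtopology X (A (Suc i))) {}"
    if "i < n" for i
    using filtered_cell_complex_mono[OF assms that]
    by unfold_locales (auto simp: singular_simplex_subtopology)
  show ?thesis
    by (auto simp: adjoint_modules_def abs_homology_pers_def abs_cohomology_pers_def
        nondegenerate_homology_pairing inclusion_of_pairs.homology_incl_carrier[OF incl]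
        inclusion_of_pairs.cohomology_incl_carrier[OF incl]
        inclusion_of_pairs.homology_pairing_adjoint[OF incl])
qed

lemma adjoint_rel_pers:
  assumes "filtered_cell_complex X n A"
  shows "adjoint_modules (rel_homology_pers k X n A) (rel_cohomology_pers k X n A)
    (\<lambda>i. homology_pairing k X (A i))"
proof -
  have incl: "inclusion_of_pairs X (A i) X (A (Suc i))" if "i < n - 1" for i
  proof -
    have "A i \<subseteq> A (Suc i)" using filtered_cell_complex_mono[OF assms] that by simp
    then show ?thesis by unfold_locales (auto simp: singular_simplex_subtopology)
  qed
  show ?thesis
    by (auto simp: adjoint_modules_def rel_homology_pers_def rel_cohomology_pers_def
        nondegenerate_homology_pairing inclusion_of_pairs.homology_incl_carrier[OF incl]
        inclusion_of_pairs.cohomology_incl_carrier[OF incl]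
        inclusion_of_pairs.homology_pairing_adjoint[OF incl])
qed

theorem proposition2p3:
  fixes X :: "'a topology" and n :: nat and A :: "nat \<Rightarrow> 'a set" and k :: nat
  assumes "filtered_cell_complex X n A"
  shows "Pers (abs_homology_pers k X n A :: ('k::field, ('k, 'a) fchain set) persistence_module) =
         Pers (abs_cohomology_pers k X n A :: ('k, ('k, 'a) cochain set) persistence_module) \<and>
         Pers (rel_homology_pers k X n A :: ('k, ('k, 'a) fchain set) persistence_module) =
         Pers (rel_cohomology_pers k X n A :: ('k, ('k, 'a) cochain set) persistence_module)"
  using Pers_adjoint[OF adjoint_abs_pers[OF assms]] Pers_adjoint[OF adjoint_rel_pers[OF assms]]
  by blast

end
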